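(* Let $m,n\ge 2$ and let $(S,T)$ be an irreducible Cuntz-type atomic representation of type 1 or type 3b(ii) of a periodic single vertex $2$-graph $\mathbb{F}_\theta^+$. Then $(S,T)$ has no wandering vectors.
   Context: Single vertex $2$-graph: for positive integers $m,n$ and a permutation $\theta$ of $\{1,\ldots,m\}\times\{1,\ldots,n\}$, $\mathbb{F}_\theta^+$ is the unital cancellative semigroup generated by $e_1,\ldots,e_m,f_1,\ldots,f_n$, where the $e_i$ generate a copy of the free semigroup $\mathbb{F}_m^+$, the $f_j$ generate a copy of $\mathbb{F}_n^+$, and $e_if_j=f_{j'}e_{i'}$ whenever $\theta(i,j)=(i',j')$. Every $w\in\mathbb{F}_\theta^+$ is uniquely $w=e_uf_v$; $|u|$ denotes the length of the word $u$. For $m,n\ge2$, $\mathbb{F}_\theta^+$ is periodic (with period $(a,-b)$) iff there are $a,b>0$ and a bijection $\gamma:\{u\in\mathbb{F}_m^+:|u|=a\}\to\{v\in\mathbb{F}_n^+:|v|=b\}$ such that $e_uf_v=f_{\gamma(u)}e_{\gamma^{-1}(v)}$ for all $|u|=a$, $|v|=b$. A Cuntz-type representation $(S,T)$ on a Hilbert space $\mathcal{H}$ consists of $S=[S_1,\ldots,S_m]$, $T=[T_1,\ldots,T_n]$ with $S_i^*S_j=\delta_{i,j}I$, $T_k^*T_l=\delta_{k,l}I$, $\sum_iS_iS_i^*=I=\sum_jT_jT_j^*$, and $S_iT_j=T_{j'}S_{i'}$ whenever $\theta(i,j)=(i',j')$. For $w=e_uf_v$, $(ST)_w=S_uT_v$.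 It is irreducible if it has no nontrivial closed reducing subspace. A representation is atomic if there is an orthonormal basis $\{\xi_k:k\ge0\}$ of $\mathcal{H}$ (the standard basis) such that each $(ST)_w$ maps each basis vector to a scalar in $\mathbb{T}\cup\{0\}$ times a basis vector. Write $\overline{\xi}=\{\lambda\xi:\lambda\in\mathbb{T}\}$. The graph of the representation has vertices $\overline{\xi_k}$, a blue edge from $\overline{\xi_i}$ to $\overline{\xi_j}$ if some $S_p\overline{\xi_i}=\overline{\xi_j}$, and a red edge if some $T_q\overline{\xi_i}=\overline{\xi_j}$. In the Cuntz-type case each vertex has exactly one blue and one red edge leading into it. $S$ is of ring type if every connected component of the blue graph contains a directed cycle, and of infinite tail type if the blue graph contains no directed cycle; similarly for $T$ with the red graph. Types of irreducible Cuntz-type atomic representations: Type 1: both $S$ and $T$ are of ring type (then there are a standard basis vector $\xi$ and nonempty words $u_0,v_0$ with $S_{u_0}\overline{\xi}=\overline{\xi}=T_{v_0}\overline{\xi}$). Type 3b(ii): both $S$ and $T$ are of infinite tail type and there are a standard basis vector $\xi_0$, integers $k,l>0$ and words $u_d\in\mathbb{F}_m^+$ with $|u_d|=k$, $v_d\in\mathbb{F}_n^+$ with $|v_d|=l$ ($d=0,-1,-2,\ldots$) such that $f_{v_{d+1}}e_{u_d}=e_{u_{d+1}}f_{v_d}$ for $d\le-1$ and $T_{v_0v_{-1}\cdots v_{-t}}^*\overline{\xi_0}=S_{u_0u_{-1}\cdots u_{-t}}^*\overline{\xi_0}$ for all $t\ge0$. A unit vector $\zeta\in\mathcal{H}$ is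 wandering for $(S,T)$ if $\langle(ST)_u\zeta,(ST)_w\zeta\rangle=\delta_{u,w}$ for all $u,w\in\mathbb{F}_\theta^+$. *)

theory Defs
  imports "HOL-Analysis.Analysis"
begin

section \<open>Complex Hilbert spaces\<close>

text \<open>
  The norm and topology are those of the underlying real inner product space, whose inner product
  is the real part of \<open>cinner\<close>; thus the norm of \<open>x\<close> is the square root of \<open>cinner x x\<close>.  The
  complex inner product is linear in its first argument.
\<close>

class complex_inner = real_inner +
  fixes scaleC :: "complex \<Rightarrow> 'a \<Rightarrow> 'a"  (infixr \<open>*\<^sub>C\<close> 75)
    and cinner :: "'a \<Rightarrow> 'a \<Rightarrow> complex"
  assumes scaleC_add_right: "a *\<^sub>C (x + y) = a *\<^sub>C x + a *\<^sub>C y"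
    and scaleC_add_left: "(a + b) *\<^sub>C x = a *\<^sub>C x + b *\<^sub>C x"
    and scaleC_scaleC: "a *\<^sub>C b *\<^sub>C x = (a * b) *\<^sub>C x"
    and scaleC_of_real: "of_real r *\<^sub>C x = r *\<^sub>R x"
    and cinner_commute: "cinner x y = cnj (cinner y x)"
    and cinner_add_left: "cinner (x + y) z = cinner x z + cinner y z"
    and cinner_scaleC_left: "cinner (a *\<^sub>C x) y = a * cinner x y"
    and inner_eq_Re_cinner: "inner x y = Re (cinner x y)"

class complex_hilbert = complex_inner + complete_space

global_interpretation complex_vector:
  vector_space "scaleC :: complex \<Rightarrow> 'a \<Rightarrow> 'a :: complex_inner"
  defines cspan = complex_vector.span
    and csubspace = complex_vector.subspace
proof
  show "1 *\<^sub>C x = x" for x :: 'a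
    using scaleC_of_real[of 1 x] by simp
qed (simp_all add: scaleC_add_right scaleC_add_left scaleC_scaleC)

definition bounded_clinear :: "('h::complex_inner \<Rightarrow> 'h) \<Rightarrow> bool" where
  "bounded_clinear A \<longleftrightarrow> bounded_linear A \<and> (\<forall>c x. A (c *\<^sub>C x) = c *\<^sub>C A x)"

text \<open>On a Hilbert space every bounded operator has exactly one adjoint in the following sense.\<close>

definition cadjoint :: "('h::complex_inner \<Rightarrow> 'h) \<Rightarrow> 'h \<Rightarrow> 'h" where
  "cadjoint A = (SOME B. \<forall>x y. cinner (A x) y = cinner x (B y))"

definition orthonormal_basis :: "(nat \<Rightarrow> 'h::complex_inner) \<Rightarrow> bool" where
  "orthonormal_basis \<xi> \<longleftrightarrow>
     (\<forall>i j. cinner (\<xi> i) (\<xi> j) = (if i = j then 1 else 0)) \<and>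
     closure (cspan (range \<xi>)) = UNIV"


section \<open>The semigroup of a single vertex 2-graph\<close>

text \<open>
  The semigroup is the monoid presented by the generators \<open>e\<^sub>i\<close> (\<open>1 \<le> i \<le> m\<close>),
  \<open>f\<^sub>j\<close> (\<open>1 \<le> j \<le> n\<close>) and the relations \<open>e\<^sub>i f\<^sub>j = f\<^sub>j\<^sub>' e\<^sub>i\<^sub>'\<close> for
  \<open>\<theta> (i, j) = (i', j')\<close>.  Its elements are the classes of words in the generators under the
  congruence generated by the relations.
\<close>

datatype generator = Egen nat | Fgen nat

abbreviation words :: "nat \<Rightarrow> nat list set" where
  "words k \<equiv> lists {1..k}"

definition generator_words :: "nat \<Rightarrow> nat \<Rightarrow> generator list set" where
  "generator_words m n = lists (Egen ` {1..m} \<union> Fgen ` {1..n})"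

definition index_box :: "nat \<Rightarrow> nat \<Rightarrow> (nat \<times> nat) set" where
  "index_box m n = {1..m} \<times> {1..n}"

inductive theta_step ::
    "nat \<Rightarrow> nat \<Rightarrow> (nat \<times> nat \<Rightarrow> nat \<times> nat) \<Rightarrow> generator list \<Rightarrow> generator list \<Rightarrow> bool"
  for m n \<theta> where
  "(i, j) \<in> index_box m n \<Longrightarrow> \<theta> (i, j) = (i', j') \<Longrightarrow>
   theta_step m n \<theta> (xs @ [Egen i, Fgen j] @ ys) (xs @ [Fgen j', Egen i'] @ ys)"

definition theta_equiv ::
    "nat \<Rightarrow> nat \<Rightarrow> (nat \<times> nat \<Rightarrow> nat \<times> nat) \<Rightarrow> (generator list \<times> generator list) set" where
  "theta_equiv m n \<theta> = {(x, y). x \<in> generator_words m n \<and> y \<in> generator_words m n \<and>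
     equivclp (theta_step m n \<theta>) x y}"

definition two_graph ::
    "nat \<Rightarrow> nat \<Rightarrow> (nat \<times> nat \<Rightarrow> nat \<times> nat) \<Rightarrow> generator list set set" where
  "two_graph m n \<theta> = generator_words m n // theta_equiv m n \<theta>"

definition ef :: "nat \<Rightarrow> nat \<Rightarrow> (nat \<times> nat \<Rightarrow> nat \<times> nat) \<Rightarrow>
    nat list \<Rightarrow> nat list \<Rightarrow> generator list set" where
  "ef m n \<theta> u v = theta_equiv m n \<theta> `` {map Egen u @ map Fgen v}"

definition fe :: "nat \<Rightarrow> nat \<Rightarrow> (nat \<times> nat \<Rightarrow> nat \<times> nat) \<Rightarrow>
    nat list \<Rightarrow> nat list \<Rightarrow> generator list set" where
  "fe m n \<theta> v u = theta_equiv m n \<theta> `` {map Fgen v @ map Egen u}"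

definition periodic :: "nat \<Rightarrow> nat \<Rightarrow> (nat \<times> nat \<Rightarrow> nat \<times> nat) \<Rightarrow> bool" where
  "periodic m n \<theta> \<longleftrightarrow>
     (\<exists>a>0. \<exists>b>0. \<exists>\<gamma>.
        bij_betw \<gamma> {u \<in> words m. length u = a} {v \<in> words n. length v = b} \<and>
        (\<forall>u \<in> words m. \<forall>v \<in> words n. length u = a \<longrightarrow> length v = b \<longrightarrow>
           ef m n \<theta> u v =
           fe m n \<theta> (\<gamma> u) (inv_into {u \<in> words m. length u = a} \<gamma> v)))"


section \<open>Representations\<close>

definition cuntz_family :: "nat \<Rightarrow> (nat \<Rightarrow> 'h::complex_inner \<Rightarrow> 'h) \<Rightarrow> bool" where
  "cuntz_family k S \<longleftrightarrow>
     (\<forall>i \<in> {1..k}. bounded_clinear (S i)) \<and>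
     (\<forall>i \<in> {1..k}. \<forall>j \<in> {1..k}. cadjoint (S i) \<circ> S j = (if i = j then id else (\<lambda>_. 0))) \<and>
     (\<forall>x. (\<Sum>i = 1..k. S i (cadjoint (S i) x)) = x)"

definition cuntz_type_rep :: "nat \<Rightarrow> nat \<Rightarrow> (nat \<times> nat \<Rightarrow> nat \<times> nat) \<Rightarrow>
    (nat \<Rightarrow> 'h::complex_inner \<Rightarrow> 'h) \<Rightarrow> (nat \<Rightarrow> 'h \<Rightarrow> 'h) \<Rightarrow> bool" where
  "cuntz_type_rep m n \<theta> S T \<longleftrightarrow>
     cuntz_family m S \<and> cuntz_family n T \<and>
     (\<forall>i j i' j'. (i, j) \<in> index_box m n \<longrightarrow> \<theta> (i, j) = (i', j') \<longrightarrow> S i \<circ> T j = T j' \<circ> S i')"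

text \<open>\<open>word_op S [i\<^sub>1, \<dots>, i\<^sub>k] = S i\<^sub>1 \<circ> \<dots> \<circ> S i\<^sub>k\<close>\<close>

definition word_op :: "(nat \<Rightarrow> 'h \<Rightarrow> 'h) \<Rightarrow> nat list \<Rightarrow> 'h \<Rightarrow> 'h" where
  "word_op S u x = foldr S u x"

text \<open>
  The operator \<open>(ST)\<^sub>w = S\<^sub>u T\<^sub>v\<close> for \<open>w = e\<^sub>u f\<^sub>v\<close>.  It does not depend on the choice of \<open>u\<close> and \<open>v\<close>:
  see \<open>rep_op_ef\<close> below; every element of the semigroup has this form by \<open>two_graph_ef\<close>.
\<close>

definition rep_op :: "nat \<Rightarrow> nat \<Rightarrow> (nat \<times> nat \<Rightarrow> nat \<times> nat) \<Rightarrow>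
    (nat \<Rightarrow> 'h \<Rightarrow> 'h) \<Rightarrow> (nat \<Rightarrow> 'h \<Rightarrow> 'h) \<Rightarrow> generator list set \<Rightarrow> 'h \<Rightarrow> 'h" where
  "rep_op m n \<theta> S T w = (SOME A. \<exists>u \<in> words m. \<exists>v \<in> words n.
     w = ef m n \<theta> u v \<and> A = word_op S u \<circ> word_op T v)"

definition reducing_subspace :: "nat \<Rightarrow> nat \<Rightarrow>
    (nat \<Rightarrow> 'h::complex_inner \<Rightarrow> 'h) \<Rightarrow> (nat \<Rightarrow> 'h \<Rightarrow> 'h) \<Rightarrow> 'h set \<Rightarrow> bool" where
  "reducing_subspace m n S T M \<longleftrightarrow> csubspace M \<and>
     (\<forall>i \<in> {1..m}. S i ` M \<subseteq> M \<and> cadjoint (S i) ` M \<subseteq> M) \<and>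
     (\<forall>j \<in> {1..n}. T j ` M \<subseteq> M \<and> cadjoint (T j) ` M \<subseteq> M)"

definition irreducible_rep :: "nat \<Rightarrow> nat \<Rightarrow>
    (nat \<Rightarrow> 'h::complex_inner \<Rightarrow> 'h) \<Rightarrow> (nat \<Rightarrow> 'h \<Rightarrow> 'h) \<Rightarrow> bool" where
  "irreducible_rep m n S T \<longleftrightarrow>
     (\<forall>M. closed M \<and> reducing_subspace m n S T M \<longrightarrow> M = {0} \<or> M = UNIV)"

definition atomic_rep :: "nat \<Rightarrow> nat \<Rightarrow> (nat \<times> nat \<Rightarrow> nat \<times> nat) \<Rightarrow>
    (nat \<Rightarrow> 'h::complex_inner \<Rightarrow> 'h) \<Rightarrow> (nat \<Rightarrow> 'h \<Rightarrow> 'h) \<Rightarrow> (nat \<Rightarrow> 'h) \<Rightarrow> bool" where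
  "atomic_rep m n \<theta> S T \<xi> \<longleftrightarrow> orthonormal_basis \<xi> \<and>
     (\<forall>w \<in> two_graph m n \<theta>. \<forall>k. \<exists>c l. (cmod c = 1 \<or> c = 0) \<and>
        rep_op m n \<theta> S T w (\<xi> k) = c *\<^sub>C \<xi> l)"

definition wandering :: "nat \<Rightarrow> nat \<Rightarrow> (nat \<times> nat \<Rightarrow> nat \<times> nat) \<Rightarrow>
    (nat \<Rightarrow> 'h::complex_inner \<Rightarrow> 'h) \<Rightarrow> (nat \<Rightarrow> 'h \<Rightarrow> 'h) \<Rightarrow> 'h \<Rightarrow> bool" where
  "wandering m n \<theta> S T \<zeta> \<longleftrightarrow> norm \<zeta> = 1 \<and>
     (\<forall>u \<in> two_graph m n \<theta>. \<forall>w \<in> two_graph m n \<theta>.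
        cinner (rep_op m n \<theta> S T u \<zeta>) (rep_op m n \<theta> S T w \<zeta>) = (if u = w then 1 else 0))"


section \<open>The graph of an atomic representation and its types\<close>

text \<open>\<open>ray x\<close> is the set of unimodular multiples of \<open>x\<close>.\<close>

definition ray :: "'h::complex_inner \<Rightarrow> 'h set" where
  "ray x = {c *\<^sub>C x | c. cmod c = 1}"

definition vertices :: "(nat \<Rightarrow> 'h::complex_inner) \<Rightarrow> 'h set set" where
  "vertices \<xi> = range (\<lambda>k. ray (\<xi> k))"

text \<open>The blue edges for \<open>S\<close> (with \<open>k = m\<close>) and the red edges for \<open>T\<close> (with \<open>k = n\<close>).\<close>

definition edges :: "nat \<Rightarrow> (nat \<Rightarrow> 'h::complex_inner \<Rightarrow> 'h) \<Rightarrow> (nat \<Rightarrow> 'h) \<Rightarrow>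
    ('h set \<times> 'h set) set" where
  "edges k S \<xi> =
     {(x, y). x \<in> vertices \<xi> \<and> y \<in> vertices \<xi> \<and> (\<exists>p \<in> {1..k}. S p ` x = y)}"

definition on_cycle :: "('v \<times> 'v) set \<Rightarrow> 'v \<Rightarrow> bool" where
  "on_cycle E x \<longleftrightarrow> (x, x) \<in> E\<^sup>+"

text \<open>Every vertex \<open>x\<close> is connected, ignoring directions of edges, to a vertex on a cycle.\<close>

definition ring_type :: "nat \<Rightarrow> (nat \<Rightarrow> 'h::complex_inner \<Rightarrow> 'h) \<Rightarrow> (nat \<Rightarrow> 'h) \<Rightarrow> bool" where
  "ring_type k S \<xi> \<longleftrightarrow>
     (\<forall>x \<in> vertices \<xi>. \<exists>y \<in> vertices \<xi>.
        (x, y) \<in> (edges k S \<xi> \<union> (edges k S \<xi>)\<inverse>)\<^sup>* \<and> on_cycle (edges k S \<xi>) y)"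

definition infinite_tail_type ::
    "nat \<Rightarrow> (nat \<Rightarrow> 'h::complex_inner \<Rightarrow> 'h) \<Rightarrow> (nat \<Rightarrow> 'h) \<Rightarrow> bool" where
  "infinite_tail_type k S \<xi> \<longleftrightarrow> \<not> (\<exists>x \<in> vertices \<xi>. on_cycle (edges k S \<xi>) x)"

definition type_1 :: "nat \<Rightarrow> nat \<Rightarrow>
    (nat \<Rightarrow> 'h::complex_inner \<Rightarrow> 'h) \<Rightarrow> (nat \<Rightarrow> 'h \<Rightarrow> 'h) \<Rightarrow> (nat \<Rightarrow> 'h) \<Rightarrow> bool" where
  "type_1 m n S T \<xi> \<longleftrightarrow> ring_type m S \<xi> \<and> ring_type n T \<xi>"

text \<open>\<open>tail_word u t\<close> is the concatenation of \<open>u 0, u (-1), \<dots>, u (-t)\<close>.\<close>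

definition tail_word :: "(int \<Rightarrow> nat list) \<Rightarrow> nat \<Rightarrow> nat list" where
  "tail_word u t = concat (map (\<lambda>s. u (- int s)) [0..<Suc t])"

definition type_3b_ii :: "nat \<Rightarrow> nat \<Rightarrow> (nat \<times> nat \<Rightarrow> nat \<times> nat) \<Rightarrow>
    (nat \<Rightarrow> 'h::complex_inner \<Rightarrow> 'h) \<Rightarrow> (nat \<Rightarrow> 'h \<Rightarrow> 'h) \<Rightarrow> (nat \<Rightarrow> 'h) \<Rightarrow> bool" where
  "type_3b_ii m n \<theta> S T \<xi> \<longleftrightarrow>
     infinite_tail_type m S \<xi> \<and> infinite_tail_type n T \<xi> \<and>
     (\<exists>k\<^sub>0. \<exists>k>0. \<exists>l>0. \<exists>u v :: int \<Rightarrow> nat list.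
        (\<forall>d\<le>0. u d \<in> words m \<and> length (u d) = k \<and> v d \<in> words n \<and> length (v d) = l) \<and>
        (\<forall>d\<le>-1. fe m n \<theta> (v (d + 1)) (u d) = ef m n \<theta> (u (d + 1)) (v d)) \<and>
        (\<forall>t. cadjoint (word_op T (tail_word v t)) ` ray (\<xi> k\<^sub>0) =
             cadjoint (word_op S (tail_word u t)) ` ray (\<xi> k\<^sub>0)))"


section \<open>Well-definedness of the operators of a representation\<close>

fun gen_op :: "(nat \<Rightarrow> 'h \<Rightarrow> 'h) \<Rightarrow> (nat \<Rightarrow> 'h \<Rightarrow> 'h) \<Rightarrow> generator \<Rightarrow> 'h \<Rightarrow> 'h" where
  "gen_op S T (Egen i) = S i"
| "gen_op S T (Fgen j) = T j"

lemma foldr_gen_op: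
  "foldr (gen_op S T) (map Egen u @ map Fgen v) = word_op S u \<circ> word_op T v"
  by (auto simp: word_op_def foldr_map o_def fun_eq_iff)

lemma theta_step_gen_op:
  assumes "cuntz_type_rep m n \<theta> S T" and "theta_step m n \<theta> x y"
  shows "foldr (gen_op S T) x = foldr (gen_op S T) y"
  using assms(2)
proof cases
  case (1 i j i' j' xs ys)
  then have "S i \<circ> T j = T j' \<circ> S i'"
    using assms(1) unfolding cuntz_type_rep_def by blast
  then have "S i (T j z) = T j' (S i' z)" for z
    by (metis comp_apply)
  then show ?thesis
    using 1 by (auto simp: fun_eq_iff)
qed

lemma equivclp_gen_op:
  assumes "cuntz_type_rep m n \<theta> S T" and "equivclp (theta_step m n \<theta>) x y"
  shows "foldr (gen_op S T) x = foldr (gen_op S T) y"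
  using assms(2) unfolding equivclp_def
  by (induction rule: rtranclp_induct)
     (use theta_step_gen_op[OF assms(1)] in \<open>auto simp: symclp_def\<close>)

lemma equiv_theta_equiv: "equiv (generator_words m n) (theta_equiv m n \<theta>)"
proof (rule equivI)
  show "trans (theta_equiv m n \<theta>)"
    unfolding theta_equiv_def by (auto intro!: transI intro: equivclp_trans)
qed (auto simp: theta_equiv_def refl_on_def sym_def intro: equivclp_sym)

lemma ef_word_in: "u \<in> words m \<Longrightarrow> v \<in> words n \<Longrightarrow> map Egen u @ map Fgen v \<in> generator_words m n"
  by (auto simp: generator_words_def lists_eq_set)

lemma rep_op_ef:
  assumes "cuntz_type_rep m n \<theta> S T" and "u \<in> words m" and "v \<in> words n"
  shows "rep_op m n \<theta> S T (ef m n \<theta> u v) = word_op S u \<circ> word_op T v"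
  unfolding rep_op_def
proof (rule some_equality)
  show "\<exists>u' \<in> words m. \<exists>v' \<in> words n. ef m n \<theta> u v = ef m n \<theta> u' v' \<and>
      word_op S u \<circ> word_op T v = word_op S u' \<circ> word_op T v'"
    using assms(2,3) by blast
next
  fix A
  assume "\<exists>u' \<in> words m. \<exists>v' \<in> words n. ef m n \<theta> u v = ef m n \<theta> u' v' \<and>
      A = word_op S u' \<circ> word_op T v'"
  then obtain u' v' where uv: "u' \<in> words m" "v' \<in> words n" "ef m n \<theta> u v = ef m n \<theta> u' v'"
    and A: "A = word_op S u' \<circ> word_op T v'"
    by blast
  have "(map Egen u @ map Fgen v, map Egen u' @ map Fgen v') \<in> theta_equiv m n \<theta>"
    using eq_equiv_class_iff[OF equiv_theta_equiv ef_word_in[OF assms(2,3)] ef_word_in[OF uv(1,2)]]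
      uv(3) unfolding ef_def by blast
  then have "equivclp (theta_step m n \<theta>) (map Egen u @ map Fgen v) (map Egen u' @ map Fgen v')"
    by (simp add: theta_equiv_def)
  then show "A = word_op S u \<circ> word_op T v"
    using equivclp_gen_op[OF assms(1)] unfolding A foldr_gen_op[symmetric] by metis
qed

lemma theta_step_context:
  assumes "theta_step m n \<theta> x y"
  shows "theta_step m n \<theta> (p @ x @ q) (p @ y @ q)"
  using assms
proof cases
  case (1 i j i' j' xs ys)
  then show ?thesis
    using theta_step.intros[of i j m n \<theta> i' j' "p @ xs" "ys @ q"] by simp
qed

lemma equivclp_theta_context:
  assumes "equivclp (theta_step m n \<theta>) x y"
  shows "equivclp (theta_step m n \<theta>) (p @ x @ q) (p @ y @ q)"
  using assms
proof (induction rule: equivclp_induct)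
  case (step y z)
  then show ?case
    using theta_step_context equivclp_into_equivclp by metis
qed simp

lemma Fgen_past_Egen:
  assumes "bij_betw \<theta> (index_box m n) (index_box m n)" and "u \<in> words m" and "j \<in> {1..n}"
  shows "\<exists>u' \<in> words m. \<exists>j' \<in> {1..n}.
    equivclp (theta_step m n \<theta>) (Fgen j # map Egen u) (map Egen u' @ [Fgen j'])"
  using assms(2,3)
proof (induction u arbitrary: j)
  case Nil
  then show ?case by (intro bexI[of _ "[]"] bexI[of _ j]) auto
next
  case (Cons i u)
  then have "(i, j) \<in> index_box m n" by (simp add: index_box_def)
  then obtain i1 j1 where ij: "(i1, j1) \<in> index_box m n" "\<theta> (i1, j1) = (i, j)"
    using assms(1) unfolding bij_betw_def by (metis imageE surj_pair)
  then have i1: "i1 \<in> {1..m}" and j1: "j1 \<in> {1..n}" by (auto simp: index_box_def)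
  obtain u' j' where u': "u' \<in> words m" "j' \<in> {1..n}"
    "equivclp (theta_step m n \<theta>) (Fgen j1 # map Egen u) (map Egen u' @ [Fgen j'])"
    using Cons.IH[OF j1] by blast
  have "equivclp (theta_step m n \<theta>)
      (Fgen j # map Egen (i # u)) (Egen i1 # Fgen j1 # map Egen u)"
    using theta_step.intros[of i1 j1 m n \<theta> i j "[]" "map Egen u"] ij by (auto intro: converse_r_into_equivclp)
  moreover have "equivclp (theta_step m n \<theta>)
      (Egen i1 # Fgen j1 # map Egen u) (map Egen (i1 # u') @ [Fgen j'])"
    using equivclp_theta_context[OF u'(3), of "[Egen i1]" "[]"] by simp
  ultimately have "equivclp (theta_step m n \<theta>)
      (Fgen j # map Egen (i # u)) (map Egen (i1 # u') @ [Fgen j'])"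
    by (rule equivclp_trans)
  moreover have "i1 # u' \<in> words m"
    using i1 u'(1) by simp
  ultimately show ?case
    using u'(2) by blast
qed

lemma two_graph_ef:
  assumes "bij_betw \<theta> (index_box m n) (index_box m n)" and "w \<in> two_graph m n \<theta>"
  shows "\<exists>u \<in> words m. \<exists>v \<in> words n. w = ef m n \<theta> u v"
proof -
  have normal: "\<exists>u \<in> words m. \<exists>v \<in> words n.
      equivclp (theta_step m n \<theta>) x (map Egen u @ map Fgen v)"
    if "x \<in> generator_words m n" for x
    using that unfolding generator_words_def
  proof (induction x)
    case Nil
    show ?case by (intro bexI[of _ "[]"]) auto
  next
    case (Cons g x)
    then obtain u v where uv: "u \<in> words m" "v \<in> words n"
      "equivclp (theta_step m n \<theta>) x (map Egen u @ map Fgen v)"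
      by auto
    have gx: "equivclp (theta_step m n \<theta>) (g # x) (g # map Egen u @ map Fgen v)"
      using equivclp_theta_context[OF uv(3), of "[g]" "[]"] by simp
    from Cons.hyps(1) consider i where "i \<in> {1..m}" "g = Egen i"
      | j where "j \<in> {1..n}" "g = Fgen j"
      by blast
    then show ?case
    proof cases
      case 1
      then show ?thesis
        using gx uv by (intro bexI[of _ "i # u"] bexI[of _ v]) auto
    next
      case 2
      then obtain u' j' where u': "u' \<in> words m" "j' \<in> {1..n}"
        "equivclp (theta_step m n \<theta>) (Fgen j # map Egen u) (map Egen u' @ [Fgen j'])"
        using Fgen_past_Egen[OF assms(1) uv(1)] by blast
      have "equivclp (theta_step m n \<theta>)
          (g # map Egen u @ map Fgen v) (map Egen u' @ map Fgen (j' # v))"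
        using equivclp_theta_context[OF u'(3), of "[]" "map Fgen v"] 2 by simp
      with gx have "equivclp (theta_step m n \<theta>) (g # x) (map Egen u' @ map Fgen (j' # v))"
        by (rule equivclp_trans)
      then show ?thesis
        using u' uv by (intro bexI[of _ u'] bexI[of _ "j' # v"]) auto
    qed
  qed
  obtain x where x: "x \<in> generator_words m n" "w = theta_equiv m n \<theta> `` {x}"
    using assms(2) unfolding two_graph_def by (auto elim: quotientE)
  then obtain u v where uv: "u \<in> words m" "v \<in> words n"
    "equivclp (theta_step m n \<theta>) x (map Egen u @ map Fgen v)"
    using normal by blast
  then have "(x, map Egen u @ map Fgen v) \<in> theta_equiv m n \<theta>"
    using x(1) ef_word_in[OF uv(1,2)] by (simp add: theta_equiv_def)
  then have "w = ef m n \<theta> u v"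
    unfolding x(2) ef_def by (rule equiv_class_eq[OF equiv_theta_equiv])
  then show ?thesis using uv(1,2) by blast
qed

end

theory Submission
  imports Defs "HOL-Computational_Algebra.Formal_Power_Series"
begin

text \<open>
  Periodicity makes \<open>W = \<Sum>\<^bsub>|u| = a\<^esub> T\<^bsub>\<gamma>(u)\<^esub> S\<^sub>u\<^sup>*\<close> a unitary in the commutant of the
  representation, with \<open>W S\<^sub>u = T\<^bsub>\<gamma>(u)\<^esub>\<close> for \<open>|u| = a\<close>.  If \<open>\<zeta>\<close> is wandering, then comparing
  \<open>T\<^bsub>\<gamma>(u)\<^esub> \<zeta>\<close> with \<open>S\<^sub>u \<zeta>\<close> and \<open>T\<^bsub>\<gamma>(u)\<gamma>(u)\<^esub> \<zeta>\<close> with \<open>S\<^bsub>uu\<^esub> \<zeta>\<close> shows that \<open>W \<zeta>\<close> and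
  \<open>W\<^sup>2 \<zeta>\<close> are orthogonal to \<open>\<zeta>\<close>, so that \<open>W\<close> is not a scalar, contrary to irreducibility.
  The spectral theorem needed for Schur's lemma is replaced by a square root: for
  \<open>A = (W + W\<^sup>*) / 2\<close> and \<open>|A| = (A\<^sup>2)\<^bsup>1/2\<^esup>\<close> the kernel of \<open>|A| - A\<close> is reducing.  It contains
  \<open>(|A| + A) \<zeta>\<close> and not \<open>\<zeta>\<close>, because \<open>\<langle>A \<zeta>, \<zeta>\<rangle> = 0 < \<langle>|A| \<zeta>, \<zeta>\<rangle>\<close>.
\<close>

section \<open>Adjoints on a Hilbert space\<close>

text \<open>Makes the series results, which are stated over \<open>banach\<close>, applicable to the
  Hilbert space.\<close>

instance complex_hilbert \<subseteq> banach ..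

text \<open>Direct method: a maximizing sequence of the concave functional \<open>J\<close> below is
  Cauchy, and the first variation vanishes at its limit. The real form suffices, since imaginary
  parts are recovered by \<open>Im_cinner\<close>.\<close>

theorem riesz_representation:
  fixes \<phi> :: "'h::{real_inner,complete_space} \<Rightarrow> real"
  assumes "bounded_linear \<phi>"
  obtains z where "\<And>x. \<phi> x = inner x z"
proof -
  interpret bounded_linear \<phi> by fact
  \<comment> \<open>The representing vector is the maximizer of \<open>J\<close>.\<close>
  define J where "J x = 2 * \<phi> x - (norm x)\<^sup>2" for x
  obtain K where K: "\<And>x. \<bar>\<phi> x\<bar> \<le> norm x * K"
    using bounded by auto
  have "J x \<le> K\<^sup>2" for x
  proof -
    have "2 * \<phi> x \<le> 2 * (norm x * K)"
      using K[of x] by linarith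
    also have "\<dots> \<le> (norm x)\<^sup>2 + K\<^sup>2"
      using sum_squares_bound[of "norm x" K] by simp
    finally show ?thesis by (simp add: J_def)
  qed
  then have bdd: "bdd_above (range J)"
    by (intro bdd_aboveI) blast
  define s where "s = (SUP x. J x)"
  have le_s: "J x \<le> s" for x
    unfolding s_def by (rule cSUP_upper[OF UNIV_I bdd])
  have "\<exists>x. s - 1 / real (Suc k) < J x" for k
    using less_cSUP_iff[OF UNIV_not_empty bdd, of "s - 1 / real (Suc k)"] by (auto simp: s_def)
  then obtain X where X: "\<And>k. s - 1 / real (Suc k) < J (X k)"
    by metis
  define r where "r k = 1 / real (Suc k)" for k
  note X = X[folded r_def]
  \<comment> \<open>Parallelogram law: \<open>J\<close> at the midpoint exceeds the mean of
    \<open>J x\<close> and \<open>J y\<close> by a quarter of the squared distance, so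
    near-maximizers are close together.\<close>
  have midpoint: "(norm (x - y))\<^sup>2 \<le> 2 * (2 * s - J x - J y)" for x y
  proof -
    have "J x + J y = 2 * J ((1/2) *\<^sub>R (x + y)) - (norm (x - y))\<^sup>2 / 2"
      unfolding J_def scaleR add power2_norm_eq_inner
      by (simp add: inner_add_left inner_add_right inner_diff_left inner_diff_right inner_commute field_simps)
    then show ?thesis
      using le_s[of "(1/2) *\<^sub>R (x + y)"] by simp
  qed
  have "Cauchy X"
  proof (rule metric_CauchyI)
    fix e :: real assume "0 < e"
    \<comment> \<open>The midpoint bound costs \<open>2 * (r i + r j)\<close>, at most
      \<open>4 * r N\<close>; hence the factor 1/4.\<close>
    then obtain N where N: "r N < e\<^sup>2 / 4"
      using nat_approx_posE[of "e\<^sup>2 / 4"] unfolding r_def by auto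
    have "dist (X i) (X j) < e" if "i \<ge> N" "j \<ge> N" for i j
    proof -
      have "r i \<le> r N" "r j \<le> r N"
        using that by (auto simp: r_def frac_le)
      then have "2 * (2 * s - J (X i) - J (X j)) < 4 * r N"
        using X[of i] X[of j] by argo
      also have "4 * r N < e\<^sup>2"
        using N by simp
      finally have "(norm (X i - X j))\<^sup>2 < e\<^sup>2"
        using midpoint[of "X i" "X j"] by simp
      then show ?thesis
        using \<open>0 < e\<close> by (simp add: dist_norm power2_less_imp_less)
    qed
    then show "\<exists>M. \<forall>i\<ge>M. \<forall>j\<ge>M. dist (X i) (X j) < e"
      by blast
  qed
  then obtain z where z: "X \<longlonglongrightarrow> z"
    using Cauchy_convergent_iff convergent_def by blast
  have "(\<lambda>k. J (X k)) \<longlonglongrightarrow> J z"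
    unfolding J_def by (intro tendsto_intros tendsto z)
  moreover have "(\<lambda>k. s - r k) \<longlonglongrightarrow> s"
    unfolding r_def using tendsto_diff[OF tendsto_const LIMSEQ_inverse_real_of_nat, of s]
    by (simp add: inverse_eq_divide)
  ultimately have "s \<le> J z"
    using X by (intro LIMSEQ_le) (auto intro: less_imp_le)
  then have max: "J x \<le> J z" for x
    using le_s[of x] by linarith
  have "\<phi> y = inner y z" for y
  proof (rule ccontr)
    assume ne: "\<phi> y \<noteq> inner y z"
    define d where "d = \<phi> y - inner y z"
    define N where "N = (norm y)\<^sup>2 + 1"
    have N: "N > 0" "(norm y)\<^sup>2 < N"
      unfolding N_def by (auto intro: add_nonneg_pos)
    have J_line: "J (z + t *\<^sub>R y) = J z + 2 * t * d - t\<^sup>2 * (norm y)\<^sup>2" for t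
      unfolding J_def add scaleR power2_norm_eq_inner d_def
      by (simp add: inner_add_left inner_add_right inner_commute power2_eq_square algebra_simps)
    \<comment> \<open>The linear gain at \<open>z\<close> along \<open>y\<close> is
      \<open>2 * t * d\<close>; the step \<open>t = d / N\<close> makes it dominate the quadratic
      loss. The 1 in \<open>N\<close> keeps the divisor positive for every \<open>y\<close>.\<close>
    have "2 * (d / N) * d \<le> (d / N)\<^sup>2 * (norm y)\<^sup>2"
      using J_line[of "d / N"] max[of "z + (d / N) *\<^sub>R y"] by linarith
    also have "\<dots> \<le> (d / N)\<^sup>2 * N"
      using N by (intro mult_left_mono) auto
    also have "\<dots> = (d / N) * d"
      using N by (simp add: power2_eq_square)
    finally have "d\<^sup>2 / N \<le> 0"
      by (simp add: power2_eq_square)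
    moreover have "d\<^sup>2 / N > 0"
      using ne N by (simp add: d_def)
    ultimately show False by simp
  qed
  then show ?thesis
    using that by blast
qed

lemma cinner_scaleC_right: "cinner x (c *\<^sub>C y) = cnj c * cinner (x::'h::complex_inner) y"
  by (metis cinner_commute cinner_scaleC_left complex_cnj_mult)

text \<open>Conjugate symmetry makes \<open>cinner x x\<close> real; sesquilinearity then shows that
  scaling by \<open>c\<close> multiplies the norm by \<open>cmod c\<close>.\<close>

lemma bounded_linear_scaleC: "bounded_linear (\<lambda>x::'h::complex_inner. c *\<^sub>C x)"
proof (rule bounded_linear_intro)
  show "c *\<^sub>C (r *\<^sub>R x) = r *\<^sub>R (c *\<^sub>C x)" for r and x :: 'h
    by (simp add: scaleC_scaleC mult.commute flip: scaleC_of_real)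
  have "(norm (c *\<^sub>C x))\<^sup>2 = (cmod c * norm x)\<^sup>2" for x :: 'h
  proof -
    have "Im (cinner x x) = 0"
      using arg_cong[OF cinner_commute[of x x], of Im] by simp
    then have "cinner x x = of_real (inner x x)"
      by (simp add: complex_eq_iff inner_eq_Re_cinner)
    moreover have "cinner (c *\<^sub>C x) (c *\<^sub>C x) = of_real ((cmod c)\<^sup>2) * cinner x x"
      using complex_norm_square[of c] by (simp add: cinner_scaleC_left cinner_scaleC_right mult.commute)
    ultimately have "inner (c *\<^sub>C x) (c *\<^sub>C x) = (cmod c)\<^sup>2 * inner x x"
      by (simp only: inner_eq_Re_cinner[of "c *\<^sub>C x"]) (simp flip: of_real_mult)
    then show ?thesis
      by (simp add: power2_norm_eq_inner power_mult_distrib)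
  qed
  then show "norm (c *\<^sub>C x) \<le> norm x * cmod c" for x :: 'h
    by (simp add: mult.commute)
qed (rule scaleC_add_right)

lemma inner_eqI:
  assumes "\<And>x. inner x y = inner x (z::'h::complex_inner)"
  shows "y = z"
proof -
  have "inner (y - z) (y - z) = 0"
    using assms[of "y - z"] by (simp add: inner_diff_right)
  then show ?thesis by simp
qed

text \<open>Transfers identities between real inner products to \<open>cinner\<close>.\<close>

lemma Im_cinner: "Im (cinner x y) = - inner (\<i> *\<^sub>C x) (y::'h::complex_inner)"
  by (simp add: inner_eq_Re_cinner cinner_scaleC_left)

text \<open>Real Riesz vectors give an operator satisfying the condition in \<open>cadjoint\<close>;
  their defining identity at \<open>\<i> *\<^sub>C x\<close> settles the imaginary part.\<close>

lemma cinner_cadjoint: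
  fixes A :: "'h::complex_hilbert \<Rightarrow> 'h"
  assumes "bounded_clinear A"
  shows "cinner (A x) y = cinner x (cadjoint A y)"
proof -
  have A: "bounded_linear A" and Ac: "\<And>c x. A (c *\<^sub>C x) = c *\<^sub>C A x"
    using assms by (auto simp: bounded_clinear_def)
  have "\<exists>z. \<forall>x. inner (A x) y = inner x z" for y
  proof -
    have "bounded_linear (\<lambda>x. inner (A x) y)"
      by (rule bounded_linear_compose[OF bounded_linear_inner_left A])
    then show ?thesis
      using riesz_representation by metis
  qed
  then obtain B where B: "\<And>x y. inner (A x) y = inner x (B y)"
    by metis
  have "cinner (A x) y = cinner x (B y)" for x y
    using B[of x y] B[of "\<i> *\<^sub>C x" y]
    by (intro complex_eqI) (simp_all add: Ac Im_cinner flip: inner_eq_Re_cinner)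
  then have "\<exists>B. \<forall>x y. cinner (A x) y = cinner x (B y)"
    by blast
  then have "\<forall>x y. cinner (A x) y = cinner x (cadjoint A y)"
    unfolding cadjoint_def by (rule someI_ex)
  then show ?thesis by blast
qed

lemma inner_cadjoint:
  fixes A :: "'h::complex_hilbert \<Rightarrow> 'h"
  assumes "bounded_clinear A"
  shows "inner (A x) y = inner x (cadjoint A y)" and "inner y (A x) = inner (cadjoint A y) x"
  using cinner_cadjoint[OF assms]
  by (simp_all add: inner_eq_Re_cinner[of "A x"] inner_eq_Re_cinner[of x]
      inner_commute[of y] inner_commute[of "cadjoint A y"])

lemma bounded_clinearD:
  assumes "bounded_clinear A"
  shows "bounded_linear A" and "A (c *\<^sub>C x) = c *\<^sub>C A x"
  using assms by (auto simp: bounded_clinear_def)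

lemma bounded_clinear_cadjoint:
  fixes A :: "'h::complex_hilbert \<Rightarrow> 'h"
  assumes "bounded_clinear A"
  shows "bounded_clinear (cadjoint A)"
  unfolding bounded_clinear_def
proof (intro conjI allI)
  note adj = inner_cadjoint(1)[OF assms, symmetric]
  interpret A: bounded_linear A
    using assms by (rule bounded_clinearD)
  obtain K where K: "\<And>x. norm (A x) \<le> norm x * K"
    using A.bounded by auto
  show "bounded_linear (cadjoint A)"
  proof (rule bounded_linear_intro)
    show "cadjoint A (x + y) = cadjoint A x + cadjoint A y" for x y
      by (rule inner_eqI) (simp add: adj inner_add_right)
    show "cadjoint A (r *\<^sub>R x) = r *\<^sub>R cadjoint A x" for r x
      by (rule inner_eqI) (simp add: adj)
    show "norm (cadjoint A y) \<le> norm y * K" for y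
    proof (cases "cadjoint A y = 0")
      case True
      have "norm y * K \<ge> 0"
        using order_trans[OF norm_ge_zero K[of y]] .
      then show ?thesis using True by simp
    next
      case False
      \<comment> \<open>Cauchy-Schwarz leaves one factor \<open>norm (cadjoint A y)\<close> on the
        right, which is cancelled; hence the separate case of norm zero.\<close>
      have "(norm (cadjoint A y))\<^sup>2 = inner (A (cadjoint A y)) y"
        by (simp add: power2_norm_eq_inner adj)
      also have "\<dots> \<le> norm (A (cadjoint A y)) * norm y"
        by (rule norm_cauchy_schwarz)
      also have "\<dots> \<le> norm (cadjoint A y) * K * norm y"
        by (intro mult_right_mono K) simp
      finally show ?thesis
        using False by (simp add: power2_eq_square mult.assoc mult.commute[of K])
    qed
  qed
  show "cadjoint A (c *\<^sub>C x) = c *\<^sub>C cadjoint A x" for c x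
  proof (rule inner_eqI)
    show "inner z (cadjoint A (c *\<^sub>C x)) = inner z (c *\<^sub>C cadjoint A x)" for z
      by (simp add: inner_eq_Re_cinner cinner_scaleC_right flip: cinner_cadjoint[OF assms])
  qed
qed

lemma cadjoint_unique:
  fixes A :: "'h::complex_hilbert \<Rightarrow> 'h"
  assumes "bounded_clinear A" and "\<And>x y. inner (A x) y = inner x (B y)"
  shows "cadjoint A = B"
  by (intro ext inner_eqI) (metis assms inner_cadjoint(1))

lemma bounded_clinear_comp:
  assumes "bounded_clinear A" and "bounded_clinear B"
  shows "bounded_clinear (\<lambda>x. A (B x))"
  using assms bounded_linear_compose unfolding bounded_clinear_def by auto

lemma bounded_clinear_sum:
  assumes "\<And>i. i \<in> I \<Longrightarrow> bounded_clinear (A i)"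
  shows "bounded_clinear (\<lambda>x. \<Sum>i\<in>I. A i x)"
  using assms unfolding bounded_clinear_def
  by (auto intro!: bounded_linear_sum simp: complex_vector.scale_sum_right)

lemma cadjoint_comp:
  fixes A B :: "'h::complex_hilbert \<Rightarrow> 'h"
  assumes "bounded_clinear A" and "bounded_clinear B"
  shows "cadjoint (\<lambda>x. A (B x)) = (\<lambda>x. cadjoint B (cadjoint A x))"
  by (rule cadjoint_unique[OF bounded_clinear_comp[OF assms]]) (simp add: inner_cadjoint(1) assms)

section \<open>Positive square roots\<close>

text \<open>The power series coefficients of \<open>(1 - x)\<^bsup>1/2\<^esup>\<close>.\<close>

definition sqrt_coeff :: "nat \<Rightarrow> real" where
  "sqrt_coeff k = (- 1) ^ k * ((1/2) gchoose k)"

lemma sqrt_coeff_0 [simp]: "sqrt_coeff 0 = 1"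
  by (simp add: sqrt_coeff_def)

lemma sqrt_coeff_1 [simp]: "sqrt_coeff (Suc 0) = - (1/2)"
  by (simp add: sqrt_coeff_def)

text \<open>The coefficient is \<open>pochhammer (- 1/2) k / fact k\<close>, where the first factor
  is negative and all others are positive.\<close>

lemma sqrt_coeff_nonpos:
  assumes "k > 0"
  shows "sqrt_coeff k \<le> 0"
proof -
  obtain j where j: "k = Suc j"
    using assms gr0_implies_Suc by blast
  have "pochhammer (1/2 :: real) j \<ge> 0"
    by (simp add: pochhammer_nonneg)
  then show ?thesis
    by (simp add: sqrt_coeff_def gbinomial_pochhammer pochhammer_rec j divide_le_0_iff
        flip: mult.assoc power_mult_distrib)
qed

text \<open>Alternating partial sums of the binomial coefficients of 1/2 have the closed form
  \<open>(- 1) ^ N * ((- 1/2) gchoose N)\<close>.\<close>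

lemma sum_sqrt_coeff_nonneg: "0 \<le> (\<Sum>k\<le>N. sqrt_coeff k)"
proof -
  have "(\<Sum>k\<le>N. sqrt_coeff k) = pochhammer (1/2) N / fact N"
    using gbinomial_sum_lower_neg[of "1/2::real" N]
    by (simp add: sqrt_coeff_def mult.commute gbinomial_pochhammer flip: mult.assoc power_mult_distrib)
  then show ?thesis
    by (simp add: pochhammer_nonneg)
qed

text \<open>Only the coefficient 1 at index 0 is positive, so the absolute partial sums are 2 minus
  the signed ones. Absolute convergence at the boundary point 1 admits operators of norm exactly
  1.\<close>

lemma summable_abs_sqrt_coeff: "summable (\<lambda>k. \<bar>sqrt_coeff k\<bar>)"
proof (rule summableI_nonneg_bounded)
  fix N
  have "(\<Sum>k<N. \<bar>sqrt_coeff k\<bar>) \<le> (\<Sum>k\<le>N. \<bar>sqrt_coeff k\<bar>)"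
    by (rule sum_mono2) auto
  also have "\<dots> = (\<Sum>k\<le>N. (if k = 0 then 2 else 0) - sqrt_coeff k)"
    using sqrt_coeff_nonpos by (intro sum.cong) (auto simp: abs_of_nonpos)
  also have "\<dots> = 2 - (\<Sum>k\<le>N. sqrt_coeff k)"
    by (simp add: sum_subtractf)
  also have "\<dots> \<le> 2"
    using sum_sqrt_coeff_nonneg[of N] by simp
  finally show "(\<Sum>k<N. \<bar>sqrt_coeff k\<bar>) \<le> 2" .
qed simp

text \<open>Coefficients of \<open>1 - x\<close> as the square of its root: Vandermonde with 1/2 +
  1/2 = 1.\<close>

lemma sqrt_coeff_convolution:
  "(\<Sum>i\<le>k. sqrt_coeff i * sqrt_coeff (k - i)) = (if k = 0 then 1 else if k = 1 then - 1 else 0)"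
proof -
  have "(\<Sum>i\<le>k. sqrt_coeff i * sqrt_coeff (k - i)) =
      (- 1) ^ k * (\<Sum>i=0..k. ((1/2::real) gchoose i) * ((1/2) gchoose (k - i)))"
    unfolding sqrt_coeff_def sum_distrib_left atLeast0AtMost
  proof (rule sum.cong)
    fix i assume "i \<in> {..k}"
    then have eq: "(- 1 :: real) ^ i * (- 1) ^ (k - i) = (- 1) ^ k"
      by (simp flip: power_add)
    then show "(- 1) ^ i * (1 / 2 gchoose i) * ((- 1) ^ (k - i) * (1 / 2 gchoose (k - i))) =
        (- 1 :: real) ^ k * ((1 / 2 gchoose i) * (1 / 2 gchoose (k - i)))"
      by (simp only: eq[symmetric] mult_ac)
  qed simp
  also have "\<dots> = (- 1) ^ k * ((1::real) gchoose k)"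
    using gbinomial_Vandermonde[of "1/2::real" "1/2" k] by simp
  also have "(1::real) gchoose k = of_nat (1 choose k)"
    using binomial_gbinomial[of 1 k, where 'a = real] by simp
  finally show ?thesis
    by (cases k) (auto simp: binomial_eq_0)
qed

lemma summable_on_imp_suminf_eq_infsum:
  fixes f :: "nat \<Rightarrow> 'a::banach"
  assumes "f summable_on UNIV"
  shows "suminf f = infsum f UNIV"
  using assms has_sum_imp_sums sums_unique summable_iff_has_sum_infsum by metis

text \<open>The product bound gives absolute summability over all pairs, which permits regrouping by
  \<open>i + j\<close>. A general array \<open>f\<close> is allowed because the terms
  \<open>q i (q j x)\<close> below are compositions of operators.\<close>

lemma double_series_eq_antidiagonal:
  fixes f :: "nat \<Rightarrow> nat \<Rightarrow> 'a::banach"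
  assumes a: "summable a" and b: "summable b"
    and bound: "\<And>i j. norm (f i j) \<le> a i * b j"
    and a_nonneg: "\<And>i. 0 \<le> a i" and b_nonneg: "\<And>j. 0 \<le> (b j :: real)"
  shows "(\<Sum>i. \<Sum>j. f i j) = (\<Sum>k. \<Sum>i\<le>k. f i (k - i))"
proof -
  have b_has_sum: "(b has_sum suminf b) UNIV"
    using b b_nonneg by (intro norm_summable_imp_has_sum) (auto intro: summable_sums)
  have a_on: "a summable_on UNIV"
    using a a_nonneg by (intro norm_summable_imp_summable_on) auto
  have "(\<lambda>(i, j). a i * b j) summable_on UNIV \<times> UNIV"
  proof (rule summable_on_SigmaI)
    show "((\<lambda>j. case (i, j) of (i, j) \<Rightarrow> a i * b j) has_sum a i * suminf b) UNIV" for i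
      using has_sum_cmult_right[OF b_has_sum] by simp
    show "(\<lambda>i. a i * suminf b) summable_on UNIV"
      by (rule summable_on_cmult_left[OF a_on])
  qed (auto simp: a_nonneg b_nonneg)
  then have "(\<lambda>p. norm (case p of (i, j) \<Rightarrow> f i j)) summable_on UNIV \<times> UNIV"
    by (rule Infinite_Sum.abs_summable_on_comparison_test') (use bound in auto)
  then have on: "(\<lambda>(i, j). f i j) summable_on UNIV \<times> UNIV"
    by (rule abs_summable_summable)
  have "f i summable_on UNIV" for i
    using bound
    by (intro norm_summable_imp_summable_on summable_norm_comparison_test[OF _ summable_mult[OF b]]) auto
  then have "(\<Sum>i. \<Sum>j. f i j) = (\<Sum>i. infsum (f i) UNIV)"
    by (simp add: summable_on_imp_suminf_eq_infsum)
  also have "\<dots> = infsum (\<lambda>i. infsum (f i) UNIV) UNIV"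
    by (intro summable_on_imp_suminf_eq_infsum summable_on_Sigma_banach[OF on])
  also have "\<dots> = infsum (\<lambda>(i, j). f i j) (UNIV \<times> UNIV)"
    by (rule infsum_Sigma'_banach[OF on])
  \<comment> \<open>The pair \<open>(i, j)\<close> corresponds to \<open>(i + j, i)\<close>; the
    subtraction is exact because \<open>i \<le> k\<close>.\<close>
  also have "\<dots> = infsum (\<lambda>(k, i). f i (k - i)) (SIGMA k:UNIV. {..k})"
    by (rule infsum_reindex_bij_witness[of _ "\<lambda>(k, i). (i, k - i)" "\<lambda>(i, j). (i + j, i)"]) auto
  finally have eq: "(\<Sum>i. \<Sum>j. f i j) = infsum (\<lambda>(k, i). f i (k - i)) (SIGMA k:UNIV. {..k})" .
  have on': "(\<lambda>(k, i). f i (k - i)) summable_on (SIGMA k:UNIV. {..k})"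
    using on
    by (rule summable_on_reindex_bij_witness[of _ "\<lambda>(k, i). (i, k - i)" "\<lambda>(i, j). (i + j, i)",
          THEN iffD1, rotated -1]) auto
  have "(\<Sum>k. \<Sum>i\<le>k. f i (k - i)) = infsum (\<lambda>k. infsum (\<lambda>i. f i (k - i)) {..k}) UNIV"
    using summable_on_Sigma_banach[OF on'] by (subst summable_on_imp_suminf_eq_infsum) auto
  also have "\<dots> = infsum (\<lambda>(k, i). f i (k - i)) (SIGMA k:UNIV. {..k})"
    by (rule infsum_Sigma'_banach[OF on'])
  finally show ?thesis using eq by simp
qed

text \<open>\<open>Q\<close> is the absolute value of \<open>A\<close>. Strict positivity off the
  kernel and commutation with everything that commutes with \<open>A\<close> are the parts of
  functional calculus that the reducing subspace requires.\<close>

lemma positive_sqrt: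
  fixes A :: "'h::{real_inner,banach} \<Rightarrow> 'h"
  assumes A: "bounded_linear A"
    and selfadj: "\<And>x y. inner (A x) y = inner x (A y)"
    and contr: "\<And>x. norm (A x) \<le> norm x"
  shows "\<exists>Q. bounded_linear Q \<and> (\<forall>x. Q (Q x) = A (A x)) \<and> (\<forall>x. A x \<noteq> 0 \<longrightarrow> inner (Q x) x > 0) \<and>
    (\<forall>C. bounded_linear C \<longrightarrow> (\<forall>y. C (A y) = A (C y)) \<longrightarrow> (\<forall>x. C (Q x) = Q (C x)))"
proof -
  interpret A: bounded_linear A by fact
  \<comment> \<open>The root is the binomial series of \<open>(1 - B)\<^bsup>1/2\<^esup>\<close> for the contraction \<open>B = 1 - A\<^sup>2\<close>.\<close>
  define B where "B x = x - A (A x)" for x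
  have B: "bounded_linear B"
    unfolding B_def by (intro bounded_linear_sub bounded_linear_ident bounded_linear_compose[OF A A])
  interpret B: bounded_linear B by fact
  have B_contr: "norm (B x) \<le> norm x" for x
  proof (rule power2_le_imp_le)
    \<comment> \<open>Self-adjointness turns the mixed term into
      \<open>(norm (A x))\<^sup>2\<close>; contractivity absorbs the last term.\<close>
    have "(norm (B x))\<^sup>2 = (norm x)\<^sup>2 - 2 * (norm (A x))\<^sup>2 + (norm (A (A x)))\<^sup>2"
      unfolding power2_norm_eq_inner B_def
      by (simp add: inner_diff_left inner_diff_right selfadj inner_commute)
    moreover have "(norm (A (A x)))\<^sup>2 \<le> (norm (A x))\<^sup>2"
      by (intro power_mono contr) simp
    moreover have "0 \<le> (norm (A x))\<^sup>2" by simp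
    ultimately show "(norm (B x))\<^sup>2 \<le> (norm x)\<^sup>2" by linarith
  qed simp
  have Bk: "bounded_linear (B ^^ k)" for k
  proof (induction k)
    case (Suc k)
    then show ?case
      using bounded_linear_compose[OF B] by (simp add: o_def)
  qed (simp add: bounded_linear_ident id_def)
  have Bk_contr: "norm ((B ^^ k) x) \<le> norm x" for k x
    by (induction k) (auto intro: order_trans[OF B_contr])
  define q where "q k x = sqrt_coeff k *\<^sub>R (B ^^ k) x" for k x
  have q: "bounded_linear (q k)" for k
    unfolding q_def by (intro bounded_linear_const_scaleR Bk)
  have norm_q: "norm (q k x) \<le> \<bar>sqrt_coeff k\<bar> * norm x" for k x
    by (simp add: q_def mult_left_mono Bk_contr)
  have summ_norm: "summable (\<lambda>k. \<bar>sqrt_coeff k\<bar> * norm x)" for x :: 'h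
    by (intro summable_mult2 summable_abs_sqrt_coeff)
  have summ: "summable (\<lambda>k. q k x)" for x
    by (rule summable_comparison_test[OF _ summ_norm[of x]]) (auto intro: norm_q)
  define Q where "Q x = (\<Sum>k. q k x)" for x
  have Q: "bounded_linear Q"
  proof (rule bounded_linear_intro)
    show "Q (x + y) = Q x + Q y" for x y
      unfolding Q_def using suminf_add[OF summ summ]
      by (simp add: bounded_linear.linear[OF q] linear_add)
    show "Q (r *\<^sub>R x) = r *\<^sub>R Q x" for r x
      unfolding Q_def using suminf_scaleR_right[OF summ]
      by (simp add: bounded_linear.linear[OF q] linear_scale)
    show "norm (Q x) \<le> norm x * (\<Sum>k. \<bar>sqrt_coeff k\<bar>)" for x
      unfolding Q_def using norm_suminf_le[OF norm_q summ_norm, of x]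
        suminf_mult2[OF summable_abs_sqrt_coeff, of "norm x"]
      by (simp add: mult.commute)
  qed
  \<comment> \<open>\<open>Q\<close> is a pointwise limit of polynomials in
    \<open>A\<close>.\<close>
  have comm: "C (Q x) = Q (C x)" if C: "bounded_linear C" and CA: "\<And>y. C (A y) = A (C y)" for C x
  proof -
    interpret C: bounded_linear C by fact
    have "C (B y) = B (C y)" for y
      by (simp add: B_def C.diff CA)
    then have "C ((B ^^ k) y) = (B ^^ k) (C y)" for k y
      by (induction k) auto
    then have "C (q k x) = q k (C x)" for k
      by (simp add: q_def C.scaleR)
    then show ?thesis
      unfolding Q_def by (simp add: C.suminf[OF summ])
  qed
  have "Q (Q x) = A (A x)" for x
  proof -
    have qq: "q i (q j x) = (sqrt_coeff i * sqrt_coeff j) *\<^sub>R (B ^^ (i + j)) x" for i j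
      by (simp add: q_def linear_scale[OF bounded_linear.linear[OF Bk]] funpow_add)
    have "Q (Q x) = (\<Sum>i. \<Sum>j. q i (q j x))"
      unfolding Q_def[of "Q x"] unfolding Q_def by (simp add: bounded_linear.suminf[OF q summ])
    also have "\<dots> = (\<Sum>k. \<Sum>i\<le>k. q i (q (k - i) x))"
    proof (rule double_series_eq_antidiagonal)
      show "norm (q i (q j x)) \<le> \<bar>sqrt_coeff i\<bar> * (\<bar>sqrt_coeff j\<bar> * norm x)" for i j
        by (rule order_trans[OF norm_q]) (intro mult_left_mono norm_q abs_ge_zero)
    qed (auto simp: summ_norm summable_abs_sqrt_coeff)
    also have "\<dots> = (\<Sum>k. (\<Sum>i\<le>k. sqrt_coeff i * sqrt_coeff (k - i)) *\<^sub>R (B ^^ k) x)"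
      by (simp add: qq scaleR_sum_left)
    \<comment> \<open>Only the coefficients of \<open>1 - x\<close> survive.\<close>
    also have "\<dots> = (\<Sum>k\<in>{0,1}. (\<Sum>i\<le>k. sqrt_coeff i * sqrt_coeff (k - i)) *\<^sub>R (B ^^ k) x)"
      unfolding sqrt_coeff_convolution by (rule suminf_finite) auto
    also have "\<dots> = x - B x"
      unfolding sqrt_coeff_convolution by simp
    finally show ?thesis by (simp add: B_def)
  qed
  moreover have "inner (Q x) x > 0" if "A x \<noteq> 0" for x
  proof -
    have Bx: "inner (B x) x = (norm x)\<^sup>2 - (norm (A x))\<^sup>2"
      by (simp add: B_def inner_diff_left selfadj power2_norm_eq_inner)
    \<comment> \<open>For \<open>k > 1\<close> the nonpositive coefficient and Cauchy-Schwarz give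
      the bound; at \<open>k = 1\<close> the exact value of \<open>inner (B x) x\<close> supplies
      the surplus.\<close>
    have ge: "inner (q k x) x \<ge> sqrt_coeff k * (norm x)\<^sup>2 + (if k = 1 then (norm (A x))\<^sup>2 / 2 else 0)" for k
    proof (cases "k \<le> 1")
      case True
      then have "k = 0 \<or> k = 1" by auto
      then show ?thesis
        using Bx by (auto simp: q_def power2_norm_eq_inner diff_divide_distrib)
    next
      case False
      have "inner ((B ^^ k) x) x \<le> norm ((B ^^ k) x) * norm x"
        by (rule norm_cauchy_schwarz)
      also have "\<dots> \<le> (norm x)\<^sup>2"
        by (simp add: power2_eq_square mult_right_mono Bk_contr)
      finally show ?thesis
        using sqrt_coeff_nonpos[of k] False by (simp add: q_def mult_left_mono_neg)
    qed
    have sm: "summable sqrt_coeff"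
      using summable_abs_sqrt_coeff by (rule summable_rabs_cancel)
    \<comment> \<open>The coefficient sum is a limit of nonnegative partial sums; strict positivity
      comes from the surplus at \<open>k = 1\<close>.\<close>
    have "0 \<le> suminf sqrt_coeff"
      using LIMSEQ_le_const[OF summable_LIMSEQ'[OF sm]] sum_sqrt_coeff_nonneg by blast
    then have "0 < suminf sqrt_coeff * (norm x)\<^sup>2 + (norm (A x))\<^sup>2 / 2"
      using that by (simp add: add_nonneg_pos)
    also have "\<dots> = (\<Sum>k. sqrt_coeff k * (norm x)\<^sup>2 + (if k = 1 then (norm (A x))\<^sup>2 / 2 else 0))"
      using sums_add[OF sums_mult2[OF summable_sums[OF sm]] sums_single[of 1 "\<lambda>_. (norm (A x))\<^sup>2 / 2"]]
      by (intro sums_unique) simp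
    also have "\<dots> \<le> (\<Sum>k. inner (q k x) x)"
      using ge
      by (intro suminf_le summable_add summable_mult2 sm summ
          bounded_linear.summable[OF bounded_linear_inner_left])
        (auto intro: sums_summable[OF sums_single])
    also have "\<dots> = inner (Q x) x"
      unfolding Q_def by (rule bounded_linear.suminf[OF bounded_linear_inner_left summ, symmetric])
    finally show ?thesis .
  qed
  ultimately show ?thesis
    using Q comm by (intro exI[of _ Q]) blast
qed

section \<open>The operator of a periodic pair\<close>

text \<open>Keeps index ranges \<open>{1..k}\<close> from being rewritten with
  \<open>Suc 0\<close>.\<close>

declare One_nat_def [simp del]

section \<open>Words of isometries in a Cuntz family\<close>

definition words_of_length :: "nat \<Rightarrow> nat \<Rightarrow> nat list set" where
  "words_of_length k r = {u \<in> words k. length u = r}"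

lemma finite_words_of_length: "finite (words_of_length k r)"
  using finite_lists_length_eq[of "{1..k}" r] by (simp add: words_of_length_def lists_eq_set)

lemma words_of_length_0 [simp]: "words_of_length k 0 = {[]}"
  by (auto simp: words_of_length_def)

lemma Cons_in_words_of_length [simp]:
  "i # u \<in> words_of_length k (Suc r) \<longleftrightarrow> i \<in> {1..k} \<and> u \<in> words_of_length k r"
  by (simp add: words_of_length_def lists_eq_set)

lemma snoc_in_words_of_length [simp]:
  "u @ [i] \<in> words_of_length k (Suc r) \<longleftrightarrow> i \<in> {1..k} \<and> u \<in> words_of_length k r"
  by (auto simp: words_of_length_def)

lemma replicate_in_words_of_length: "i \<in> {1..k} \<Longrightarrow> replicate r i \<in> words_of_length k r"
  by (induction r) simp_all

lemma words_of_length_Suc: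
  "words_of_length k (Suc r) = (\<lambda>(i, u). i # u) ` ({1..k} \<times> words_of_length k r)"
proof (rule set_eqI)
  show "w \<in> words_of_length k (Suc r) \<longleftrightarrow> w \<in> (\<lambda>(i, u). i # u) ` ({1..k} \<times> words_of_length k r)" for w
    by (cases w) (auto simp: words_of_length_def)
qed

lemma words_of_length_SucE:
  assumes "w \<in> words_of_length k (Suc r)"
  obtains i u where "w = i # u" and "i \<in> {1..k}" and "u \<in> words_of_length k r"
  using assms unfolding words_of_length_Suc by auto

lemma word_op_Nil [simp]: "word_op S [] = (\<lambda>x. x)"
  by (simp add: word_op_def fun_eq_iff)

lemma word_op_Cons [simp]: "word_op S (i # u) = (\<lambda>x. S i (word_op S u x))"
  by (simp add: word_op_def fun_eq_iff)

lemma word_op_append: "word_op S (u @ v) x = word_op S u (word_op S v x)"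
  by (simp add: word_op_def)

context
  fixes k :: nat and S :: "nat \<Rightarrow> 'h::complex_hilbert \<Rightarrow> 'h"
  assumes family: "cuntz_family k S"
begin

lemma cuntz_bounded_clinear: "i \<in> {1..k} \<Longrightarrow> bounded_clinear (S i)"
  using family by (auto simp: cuntz_family_def)

lemma cuntz_sum: "(\<Sum>i = 1..k. S i (cadjoint (S i) x)) = x"
  using family by (auto simp: cuntz_family_def)

lemma cuntz_inner:
  assumes "i \<in> {1..k}" and "j \<in> {1..k}"
  shows "inner (S i x) (S j y) = (if i = j then inner x y else 0)"
proof -
  have "cadjoint (S i) \<circ> S j = (if i = j then id else (\<lambda>_. 0))"
    using family assms by (simp add: cuntz_family_def)
  from fun_cong[OF this, of y] have "cadjoint (S i) (S j y) = (if i = j then y else 0)"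
    by (simp split: if_splits)
  then show ?thesis
    by (subst inner_cadjoint(1)[OF cuntz_bounded_clinear[OF assms(1)]]) simp
qed

lemma word_op_bounded_clinear:
  "u \<in> words_of_length k r \<Longrightarrow> bounded_clinear (word_op S u)"
proof (induction r arbitrary: u)
  case 0
  then show ?case by (simp add: bounded_clinear_def bounded_linear_ident)
next
  case (Suc r)
  from Suc.prems obtain i w where "u = i # w" "i \<in> {1..k}" "w \<in> words_of_length k r"
    by (rule words_of_length_SucE)
  then show ?case
    using bounded_clinear_comp[OF cuntz_bounded_clinear Suc.IH] by simp
qed

text \<open>First letters are peeled off in parallel; with equal lengths neither word is a proper
  prefix of the other, so distinct words have orthogonal ranges.\<close>

lemma word_op_inner:
  assumes "u \<in> words_of_length k r" and "u' \<in> words_of_length k r"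
  shows "inner (word_op S u x) (word_op S u' y) = (if u = u' then inner x y else 0)"
  using assms
proof (induction r arbitrary: u u')
  case 0
  then show ?case by simp
next
  case (Suc r)
  obtain i w where "u = i # w" "i \<in> {1..k}" "w \<in> words_of_length k r"
    using Suc.prems(1) by (rule words_of_length_SucE)
  moreover obtain i' w' where "u' = i' # w'" "i' \<in> {1..k}" "w' \<in> words_of_length k r"
    using Suc.prems(2) by (rule words_of_length_SucE)
  ultimately show ?case
    by (simp add: cuntz_inner Suc.IH)
qed

lemma word_op_cadjoint:
  assumes "u \<in> words_of_length k r" and "u' \<in> words_of_length k r"
  shows "cadjoint (word_op S u) (word_op S u' x) = (if u = u' then x else 0)"
  by (rule inner_eqI) (auto simp: word_op_inner[OF assms]
      simp flip: inner_cadjoint(1)[OF word_op_bounded_clinear[OF assms(1)]])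

lemma word_op_sum: "(\<Sum>u \<in> words_of_length k r. word_op S u (cadjoint (word_op S u) x)) = x"
proof (induction r arbitrary: x)
  case 0
  have "cadjoint (\<lambda>x::'h. x) = (\<lambda>x. x)"
    by (rule cadjoint_unique) (auto simp: bounded_clinear_def bounded_linear_ident)
  then show ?case by simp
next
  case (Suc r)
  have "(\<Sum>u \<in> words_of_length k (Suc r). word_op S u (cadjoint (word_op S u) x)) =
      (\<Sum>(i, u) \<in> {1..k} \<times> words_of_length k r.
        word_op S (i # u) (cadjoint (word_op S (i # u)) x))"
    unfolding words_of_length_Suc by (subst sum.reindex) (auto simp: inj_on_def case_prod_unfold)
  also have "\<dots> = (\<Sum>i = 1..k. \<Sum>u \<in> words_of_length k r.
        S i (word_op S u (cadjoint (word_op S u) (cadjoint (S i) x))))"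
    by (subst sum.cartesian_product[symmetric])
      (auto intro!: sum.cong simp: cadjoint_comp cuntz_bounded_clinear word_op_bounded_clinear)
  also have "\<dots> = (\<Sum>i = 1..k. S i (\<Sum>u \<in> words_of_length k r.
        word_op S u (cadjoint (word_op S u) (cadjoint (S i) x))))"
  proof (rule sum.cong)
    fix i assume "i \<in> {1..k}"
    then interpret bounded_linear "S i"
      by (intro bounded_clinearD cuntz_bounded_clinear)
    show "(\<Sum>u \<in> words_of_length k r. S i (word_op S u (cadjoint (word_op S u) (cadjoint (S i) x)))) =
        S i (\<Sum>u \<in> words_of_length k r. word_op S u (cadjoint (word_op S u) (cadjoint (S i) x)))"
      by (simp add: sum)
  qed simp
  also have "\<dots> = x"
    by (simp add: Suc.IH cuntz_sum)
  finally show ?case .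
qed

text \<open>Reads words off operator identities: cancellation takes place in the representation, in
  place of unique factorization in the semigroup.\<close>

lemma word_op_eqD:
  assumes "u \<in> words_of_length k r" and "u' \<in> words_of_length k r"
    and eq: "word_op S u x = word_op S u' y" and "x \<noteq> 0"
  shows "u = u'" and "x = y"
proof -
  have "inner x x = inner (word_op S u x) (word_op S u' y)"
    using word_op_inner[OF assms(1,1), of x x] by (simp add: eq)
  then show "u = u'"
    using word_op_inner[OF assms(1,2), of x y] \<open>x \<noteq> 0\<close> by (auto split: if_splits)
  then show "x = y"
    using word_op_cadjoint[OF assms(1,1)] eq by metis
qed

lemma word_op_nonzero:
  assumes "u \<in> words_of_length k r" and "x \<noteq> 0"
  shows "word_op S u x \<noteq> 0"
  using word_op_inner[OF assms(1,1), of x x] assms(2) by auto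

text \<open>By \<open>word_op_sum\<close> every vector is a sum of vectors in the ranges of words of
  length \<open>r\<close>.\<close>

lemma operator_eqI:
  assumes "bounded_linear A" and "bounded_linear B"
    and eq: "\<And>u x. u \<in> words_of_length k r \<Longrightarrow> A (word_op S u x) = B (word_op S u x)"
  shows "A x = B x"
proof -
  let ?s = "\<Sum>u \<in> words_of_length k r. word_op S u (cadjoint (word_op S u) x)"
  have "A ?s = B ?s"
    unfolding linear_sum[OF bounded_linear.linear[OF assms(1)]]
      linear_sum[OF bounded_linear.linear[OF assms(2)]]
    by (intro sum.cong eq refl)
  then show ?thesis
    by (simp only: word_op_sum)
qed

end

text \<open>Retains the relations as operator identities. Letter exchange is listed in both
  directions and the second word of periodicity is written \<open>\<gamma> u'\<close>, so the
  setting is symmetric under exchanging \<open>S\<close> with \<open>T\<close> and inverting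
  \<open>\<gamma>\<close>.\<close>

locale periodic_pair =
  fixes m n a b :: nat and \<gamma> :: "nat list \<Rightarrow> nat list"
    and S T :: "nat \<Rightarrow> 'h::complex_hilbert \<Rightarrow> 'h"
  assumes S: "cuntz_family m S" and T: "cuntz_family n T"
    and a_pos: "a > 0" and b_pos: "b > 0"
    and \<gamma>: "bij_betw \<gamma> (words_of_length m a) (words_of_length n b)"
    and ST: "\<And>i j. i \<in> {1..m} \<Longrightarrow> j \<in> {1..n} \<Longrightarrow>
      \<exists>j' \<in> {1..n}. \<exists>i' \<in> {1..m}. \<forall>x. S i (T j x) = T j' (S i' x)"
    and TS: "\<And>j i. j \<in> {1..n} \<Longrightarrow> i \<in> {1..m} \<Longrightarrow>
      \<exists>i' \<in> {1..m}. \<exists>j' \<in> {1..n}. \<forall>x. T j (S i x) = S i' (T j' x)"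
    and periodic: "\<And>u u' x. u \<in> words_of_length m a \<Longrightarrow> u' \<in> words_of_length m a \<Longrightarrow>
      word_op S u (word_op T (\<gamma> u') x) = word_op T (\<gamma> u) (word_op S u' x)"
begin

lemma \<gamma>_in: "u \<in> words_of_length m a \<Longrightarrow> \<gamma> u \<in> words_of_length n b"
  using bij_betwE[OF \<gamma>] by blast

lemma swapped: "periodic_pair n m b a (inv_into (words_of_length m a) \<gamma>) T S"
proof
  show "bij_betw (inv_into (words_of_length m a) \<gamma>) (words_of_length n b) (words_of_length m a)"
    by (rule bij_betw_inv_into[OF \<gamma>])
  fix v v' x
  assume v: "v \<in> words_of_length n b" "v' \<in> words_of_length n b"
  let ?\<delta> = "inv_into (words_of_length m a) \<gamma>"
  have "?\<delta> v \<in> words_of_length m a" "?\<delta> v' \<in> words_of_length m a" "\<gamma> (?\<delta> v) = v" "\<gamma> (?\<delta> v') = v'"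
    using v bij_betwE[OF bij_betw_inv_into[OF \<gamma>]] bij_betw_inv_into_right[OF \<gamma>] by blast+
  then show "word_op T v (word_op S (?\<delta> v') x) = word_op S (?\<delta> v) (word_op T v' x)"
    using periodic[of "?\<delta> v" "?\<delta> v'" x] by simp
next
  show "\<exists>j' \<in> {1..m}. \<exists>i' \<in> {1..n}. \<forall>x. T i (S j x) = S j' (T i' x)"
    if "i \<in> {1..n}" "j \<in> {1..m}" for i j
    by (rule TS[OF that])
  show "\<exists>i' \<in> {1..n}. \<exists>j' \<in> {1..m}. \<forall>x. S j (T i x) = T i' (S j' x)"
    if "j \<in> {1..m}" "i \<in> {1..n}" for i j
    by (rule ST[OF that])
qed (rule S T a_pos b_pos)+

lemma \<gamma>_surj:
  assumes "v \<in> words_of_length n b"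
  obtains u where "u \<in> words_of_length m a" and "\<gamma> u = v"
proof -
  have "v \<in> \<gamma> ` words_of_length m a"
    using assms by (simp only: bij_betw_imp_surj_on[OF \<gamma>])
  then show thesis
    using that by (metis (no_types, lifting) imageE)
qed

section \<open>Moving letters past words\<close>

lemma letter_past_word:
  assumes "v \<in> words_of_length n r" and "i \<in> {1..m}"
  shows "\<exists>v' \<in> words_of_length n r. \<exists>i' \<in> {1..m}.
    \<forall>x. S i (word_op T v x) = word_op T v' (S i' x)"
  using assms
proof (induction r arbitrary: v i)
  case 0
  then show ?case by auto
next
  case (Suc r)
  obtain j w where v: "v = j # w" "j \<in> {1..n}" "w \<in> words_of_length n r"
    using Suc.prems(1) by (rule words_of_length_SucE)
  obtain j' i1 where 1: "j' \<in> {1..n}" "i1 \<in> {1..m}" "\<And>x. S i (T j x) = T j' (S i1 x)"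
    using ST[OF Suc.prems(2) v(2)] by blast
  obtain w' i' where 2: "w' \<in> words_of_length n r" "i' \<in> {1..m}"
    "\<And>x. S i1 (word_op T w x) = word_op T w' (S i' x)"
    using Suc.IH[OF v(3) 1(2)] by blast
  have "j' # w' \<in> words_of_length n (Suc r)"
    "\<forall>x. S i (word_op T v x) = word_op T (j' # w') (S i' x)"
    using 1 2 by (simp_all add: v(1))
  then show ?case
    using 2(2) by blast
qed

lemma word_past_word:
  assumes "v \<in> words_of_length n s" and "u \<in> words_of_length m r"
  shows "\<exists>v' \<in> words_of_length n s. \<exists>u' \<in> words_of_length m r.
    \<forall>x. word_op S u (word_op T v x) = word_op T v' (word_op S u' x)"
  using assms(2)
proof (induction r arbitrary: u)
  case 0
  then show ?case using assms(1) by auto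
next
  case (Suc r)
  obtain i w where u: "u = i # w" "i \<in> {1..m}" "w \<in> words_of_length m r"
    using Suc.prems by (rule words_of_length_SucE)
  obtain v1 w1 where 1: "v1 \<in> words_of_length n s" "w1 \<in> words_of_length m r"
    "\<And>x. word_op S w (word_op T v x) = word_op T v1 (word_op S w1 x)"
    using Suc.IH[OF u(3)] by blast
  obtain v' i' where 2: "v' \<in> words_of_length n s" "i' \<in> {1..m}"
    "\<And>x. S i (word_op T v1 x) = word_op T v' (S i' x)"
    using letter_past_word[OF 1(1) u(2)] by blast
  have "i' # w1 \<in> words_of_length m (Suc r)"
    "\<forall>x. word_op S u (word_op T v x) = word_op T v' (word_op S (i' # w1) x)"
    using 1 2 by (simp_all add: u(1))
  then show ?case
    using 2(1) by blast
qed

text \<open>The key point is that the letter produced on the right is the last letter \<open>j\<close> of \<open>i # u\<close>.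
  This is seen after multiplying from the left by any word that completes \<open>i\<close> to a word of
  length \<open>a\<close>, for which periodicity gives the whole word on the right.\<close>

lemma letter_past_\<gamma>:
  assumes "i \<in> {1..m}" and "u @ [j] \<in> words_of_length m a"
  shows "S i (word_op T (\<gamma> (u @ [j])) x) = word_op T (\<gamma> (i # u)) (S j x)"
\<comment> \<open>A nonzero vector is required to recover words from operator identities; on the
  zero space every equation holds.\<close>
proof (cases "\<exists>z::'h. z \<noteq> 0")
  case False
  then show ?thesis by metis
next
  case True
  then obtain z :: 'h where z: "z \<noteq> 0" by blast
  obtain a' where a: "a = Suc a'"
    using a_pos gr0_implies_Suc by blast
  have j: "j \<in> {1..m}" and u: "u \<in> words_of_length m a'" and iu: "i # u \<in> words_of_length m a"
    using assms by (simp_all add: a)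
  let ?uj = "u @ [j]"
  note \<gamma>uj = \<gamma>_in[OF assms(2)]
  obtain v i' where v: "v \<in> words_of_length n b" "i' \<in> {1..m}"
    "\<And>x. S i (word_op T (\<gamma> ?uj) x) = word_op T v (S i' x)"
    using letter_past_word[OF \<gamma>uj assms(1)] by blast
  define p where "p = replicate a' i @ [i]"
  have p: "p \<in> words_of_length m a"
    using assms(1) by (simp add: p_def a replicate_in_words_of_length)
  obtain v1 p1 where 1: "v1 \<in> words_of_length n b" "p1 \<in> words_of_length m a'"
    "\<And>x. word_op S (replicate a' i) (word_op T v x) = word_op T v1 (word_op S p1 x)"
    using word_past_word[OF v(1) replicate_in_words_of_length[OF assms(1)]] by blast
  \<comment> \<open>One vector in two forms: by periodicity for the whole word \<open>p\<close>, and
    by moving its letters separately. Cancelling the \<open>T\<close> words identifies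
    \<open>u @ [j]\<close> with \<open>p1 @ [i']\<close>.\<close>
  have "word_op T (\<gamma> p) (word_op S ?uj z) = word_op S p (word_op T (\<gamma> ?uj) z)"
    by (rule periodic[OF p assms(2), symmetric])
  also have "\<dots> = word_op T v1 (word_op S (p1 @ [i']) z)"
    by (simp add: p_def word_op_append v(3) 1(3))
  finally have "word_op S ?uj z = word_op S (p1 @ [i']) z"
    by (rule word_op_eqD(2)[OF T \<gamma>_in[OF p] 1(1) _ word_op_nonzero[OF S assms(2) z]])
  then have "?uj = p1 @ [i']"
    using 1(2) v(2) by (intro word_op_eqD(1)[OF S assms(2) _ _ z]) (simp_all add: a)
  then have i': "i' = j" by simp
  obtain v2 j2 where 2: "v2 \<in> words_of_length n b" "j2 \<in> {1..m}"
    "\<And>x. S j (word_op T (\<gamma> ?uj) x) = word_op T v2 (S j2 x)"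
    using letter_past_word[OF \<gamma>uj j] by blast
  obtain y where y: "y \<in> words_of_length m a" "\<gamma> y = v2"
    using 2(1) by (rule \<gamma>_surj)
  \<comment> \<open>The word \<open>i # u @ [j]\<close> is moved past
    \<open>\<gamma> (u @ [j])\<close> in two ways: split as \<open>i\<close> and
    \<open>u @ [j]\<close>, and as \<open>i # u\<close> and \<open>j\<close>. The leading
    \<open>T\<close> words, both of length \<open>b\<close>, must coincide.\<close>
  have "word_op T v (S j (word_op S ?uj z)) = S i (word_op S ?uj (word_op T (\<gamma> ?uj) z))"
    by (simp only: periodic[OF assms(2) assms(2)] v(3) i')
  also have "\<dots> = word_op S (i # u) (word_op T (\<gamma> y) (S j2 z))"
    by (simp add: word_op_append 2(3) y(2))
  also have "\<dots> = word_op T (\<gamma> (i # u)) (word_op S y (S j2 z))"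
    by (rule periodic[OF iu y(1)])
  finally have "word_op T v (word_op S (j # ?uj) z) = word_op T (\<gamma> (i # u)) (word_op S y (S j2 z))"
    by simp
  moreover have "word_op S (j # ?uj) z \<noteq> 0"
    by (rule word_op_nonzero[OF S _ z, of _ "Suc a"]) (use assms(2) j in simp)
  ultimately have "v = \<gamma> (i # u)"
    by (rule word_op_eqD(1)[OF T v(1) \<gamma>_in[OF iu]])
  then show ?thesis
    using v(3) i' by simp
qed

section \<open>The unitary in the commutant\<close>

definition W :: "'h \<Rightarrow> 'h" where
  "W x = (\<Sum>u \<in> words_of_length m a. word_op T (\<gamma> u) (cadjoint (word_op S u) x))"

lemma W_bounded_clinear: "bounded_clinear W"
  unfolding W_def
proof (rule bounded_clinear_sum)
  fix u assume "u \<in> words_of_length m a"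
  then have "bounded_clinear (word_op T (\<gamma> u))" "bounded_clinear (cadjoint (word_op S u))"
    by (simp_all add: word_op_bounded_clinear[OF T \<gamma>_in]
        bounded_clinear_cadjoint[OF word_op_bounded_clinear[OF S]])
  then show "bounded_clinear (\<lambda>x. word_op T (\<gamma> u) (cadjoint (word_op S u) x))"
    by (rule bounded_clinear_comp)
qed

lemma W_word:
  assumes "u \<in> words_of_length m a"
  shows "W (word_op S u x) = word_op T (\<gamma> u) x"
proof -
  have "word_op T (\<gamma> u') 0 = 0" if "u' \<in> words_of_length m a" for u'
    using bounded_clinearD(1)[OF word_op_bounded_clinear[OF T \<gamma>_in[OF that]]]
    by (intro linear_0 bounded_linear.linear)
  then have "W (word_op S u x) = (\<Sum>u' \<in> words_of_length m a. if u' = u then word_op T (\<gamma> u) x else 0)"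
    unfolding W_def using assms by (intro sum.cong) (simp_all add: word_op_cadjoint[OF S])
  then show ?thesis
    using assms finite_words_of_length by simp
qed

text \<open>On \<open>word_op S (u0 @ [j]) x\<close> both sides are
  \<open>word_op T (\<gamma> (i # u0)) (S j x)\<close>: the left by regrouping
  \<open>i # u0 @ [j]\<close> as \<open>i # u0\<close> followed by \<open>j\<close>, the right by
  \<open>letter_past_\<gamma>\<close>.\<close>

lemma W_S:
  assumes "i \<in> {1..m}"
  shows "W (S i x) = S i (W x)"
proof (rule operator_eqI[OF S, of "\<lambda>x. W (S i x)" "\<lambda>x. S i (W x)" a])
  show "bounded_linear (\<lambda>x. W (S i x))" "bounded_linear (\<lambda>x. S i (W x))"
    using bounded_clinear_comp[OF W_bounded_clinear cuntz_bounded_clinear[OF S assms]]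
      bounded_clinear_comp[OF cuntz_bounded_clinear[OF S assms] W_bounded_clinear]
    by (simp_all add: bounded_clinear_def)
  fix u x assume u: "u \<in> words_of_length m a"
  obtain a' where a: "a = Suc a'"
    using a_pos gr0_implies_Suc by blast
  obtain u0 j where uj: "u = u0 @ [j]"
    using u a by (cases u rule: rev_cases) (simp_all add: words_of_length_def)
  have "S i (W (word_op S u x)) = word_op T (\<gamma> (i # u0)) (S j x)"
    using letter_past_\<gamma>[OF assms] u by (simp add: W_word uj)
  moreover have "W (word_op S (i # u0) (S j x)) = word_op T (\<gamma> (i # u0)) (S j x)"
    by (rule W_word) (use u assms in \<open>simp add: a uj\<close>)
  ultimately show "W (S i (word_op S u x)) = S i (W (word_op S u x))"
    by (simp add: uj word_op_append)
qed

lemma W_word_commute: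
  assumes "u \<in> words_of_length m a"
  shows "W (word_op S u x) = word_op S u (W x)"
proof -
  have "set u \<subseteq> {1..m}"
    using assms by (simp add: words_of_length_def lists_eq_set)
  then show ?thesis
    by (induction u) (simp_all add: W_S)
qed

text \<open>The same construction with \<open>S\<close> and \<open>T\<close> exchanged; it turns out
  to be both inverse and adjoint of \<open>W\<close>, and it commutes with every \<open>T j\<close>
  by the exchanged form of \<open>W_S\<close>.\<close>

definition W_inv :: "'h \<Rightarrow> 'h" where
  "W_inv = periodic_pair.W n b (inv_into (words_of_length m a) \<gamma>) T S"

interpretation sw: periodic_pair n m b a "inv_into (words_of_length m a) \<gamma>" T S
  by (rule swapped)

lemma W_inv_bounded_clinear: "bounded_clinear W_inv"
  unfolding W_inv_def by (rule sw.W_bounded_clinear)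

lemma W_inv_word:
  assumes "u \<in> words_of_length m a"
  shows "W_inv (word_op T (\<gamma> u) x) = word_op S u x"
  unfolding W_inv_def using sw.W_word[OF \<gamma>_in[OF assms]] bij_betw_inv_into_left[OF \<gamma> assms] by simp

lemma W_inv_W [simp]: "W_inv (W x) = x"
proof (rule operator_eqI[OF S, of "\<lambda>x. W_inv (W x)" "\<lambda>x. x" a])
  show "bounded_linear (\<lambda>x. W_inv (W x))"
    using bounded_clinear_comp[OF W_inv_bounded_clinear W_bounded_clinear]
    by (simp add: bounded_clinear_def)
  show "W_inv (W (word_op S u x)) = word_op S u x" if "u \<in> words_of_length m a" for u x
    using that by (simp only: W_word W_inv_word)
qed (rule bounded_linear_ident)

lemma W_W_inv [simp]: "W (W_inv x) = x"
proof (rule operator_eqI[OF T, of "\<lambda>x. W (W_inv x)" "\<lambda>x. x" b])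
  show "bounded_linear (\<lambda>x. W (W_inv x))"
    using bounded_clinear_comp[OF W_bounded_clinear W_inv_bounded_clinear]
    by (simp add: bounded_clinear_def)
  fix v x assume "v \<in> words_of_length n b"
  then obtain u where u: "u \<in> words_of_length m a" "\<gamma> u = v"
    by (rule \<gamma>_surj)
  show "W (W_inv (word_op T v x)) = word_op T v x"
    unfolding u(2)[symmetric] by (simp only: W_word[OF u(1)] W_inv_word[OF u(1)])
qed (rule bounded_linear_ident)

lemma W_T:
  assumes "j \<in> {1..n}"
  shows "W (T j x) = T j (W x)"
proof -
  have "W_inv (T j (W x)) = T j x"
    using sw.W_S[OF assms, of "W x"] unfolding W_inv_def[symmetric] by simp
  then show ?thesis
    by (metis W_W_inv)
qed

text \<open>Adjoints are taken termwise, and the sum is reindexed along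
  \<open>v = \<gamma> u\<close>. Together with invertibility this makes \<open>W\<close>
  unitary.\<close>

lemma inner_W: "inner (W x) y = inner x (W_inv y)"
proof -
  have "inner (W x) y = (\<Sum>u \<in> words_of_length m a. inner x (word_op S u (cadjoint (word_op T (\<gamma> u)) y)))"
    unfolding W_def inner_sum_left
  proof (rule sum.cong)
    fix u assume u: "u \<in> words_of_length m a"
    then have "bounded_clinear (word_op S u)" "bounded_clinear (word_op T (\<gamma> u))"
      by (simp_all add: word_op_bounded_clinear[OF T \<gamma>_in] word_op_bounded_clinear[OF S])
    then show "inner (word_op T (\<gamma> u) (cadjoint (word_op S u) x)) y =
        inner x (word_op S u (cadjoint (word_op T (\<gamma> u)) y))"
      by (simp add: inner_cadjoint)
  qed simp
  also have "\<dots> = (\<Sum>v \<in> words_of_length n b. inner x (word_op S (inv_into (words_of_length m a) \<gamma> v)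
      (cadjoint (word_op T v) y)))"
    by (subst sum.reindex_bij_betw[OF \<gamma>, symmetric])
      (simp add: bij_betw_inv_into_left[OF \<gamma>] cong: sum.cong)
  also have "\<dots> = inner x (W_inv y)"
    by (simp add: W_inv_def sw.W_def inner_sum_right)
  finally show ?thesis .
qed

end

section \<open>Irreducibility and the commutant\<close>

context periodic_pair
begin

text \<open>The first orthogonality makes the quadratic form of \<open>A\<close> vanish at
  \<open>\<zeta>\<close>; the second makes \<open>W \<zeta>\<close> and \<open>W_inv \<zeta>\<close>
  orthogonal, so that \<open>A \<zeta>\<close> is nonzero and the form of \<open>Q\<close> is
  strictly positive there.\<close>

lemma not_irreducible_if_orthogonal:
  assumes "\<zeta> \<noteq> 0"
    and W1: "inner (W \<zeta>) \<zeta> = 0" and W2: "inner (W (W \<zeta>)) \<zeta> = 0"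
  shows "\<not> irreducible_rep m n S T"
proof
  assume irreducible: "irreducible_rep m n S T"
  interpret W: bounded_linear W
    by (rule bounded_clinearD(1)[OF W_bounded_clinear])
  interpret W_inv: bounded_linear W_inv
    by (rule bounded_clinearD(1)[OF W_inv_bounded_clinear])
  have inner_W_inv: "inner (W_inv x) y = inner x (W y)" for x y
    using inner_W[of y x] by (simp add: inner_commute)
  define A where "A x = (1/2) *\<^sub>R (W x + W_inv x)" for x
  have A: "bounded_linear A"
    unfolding A_def
    by (intro bounded_linear_const_scaleR bounded_linear_add W.bounded_linear_axioms W_inv.bounded_linear_axioms)
  have A_selfadj: "inner (A x) y = inner x (A y)" for x y
    by (simp add: A_def inner_add_left inner_add_right inner_W inner_W_inv)
  have norm_W: "norm (W x) = norm x" and norm_W_inv: "norm (W_inv x) = norm x" for x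
    by (simp_all add: norm_eq_sqrt_inner inner_W inner_W_inv)
  have A_contr: "norm (A x) \<le> norm x" for x
    using norm_triangle_ineq[of "W x" "W_inv x"] by (simp add: A_def norm_W norm_W_inv)
  obtain Q where Q: "bounded_linear Q" and QQ: "\<forall>x. Q (Q x) = A (A x)"
    and Q_pos: "\<forall>x. A x \<noteq> 0 \<longrightarrow> inner (Q x) x > 0"
    and comm: "\<forall>C. bounded_linear C \<longrightarrow> (\<forall>y. C (A y) = A (C y)) \<longrightarrow> (\<forall>x. C (Q x) = Q (C x))"
    using positive_sqrt[OF A A_selfadj A_contr] by (elim exE conjE)
  have Q_comm: "C (Q x) = Q (C x)" if "bounded_linear C" "\<And>y. C (A y) = A (C y)" for C x
    using comm that by blast
  interpret A: bounded_linear A by fact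
  interpret Q: bounded_linear Q by fact

  have A\<zeta>: "inner (A \<zeta>) \<zeta> = 0"
    using W1 inner_W_inv[of \<zeta> \<zeta>] by (simp add: A_def inner_add_left inner_commute[of \<zeta>])
  have "inner (W \<zeta>) (W_inv \<zeta>) = 0" "inner (W \<zeta>) (W \<zeta>) = inner \<zeta> \<zeta>"
    "inner (W_inv \<zeta>) (W_inv \<zeta>) = inner \<zeta> \<zeta>"
    using W2 by (simp_all add: inner_W inner_W_inv)
  then have "inner (W \<zeta> + W_inv \<zeta>) (W \<zeta> + W_inv \<zeta>) = 2 * inner \<zeta> \<zeta>"
    by (simp add: inner_add_left inner_add_right inner_commute[of "W_inv \<zeta>" "W \<zeta>"])
  then have "A \<zeta> \<noteq> 0"
    using \<open>\<zeta> \<noteq> 0\<close> by (auto simp: A_def)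
  then have Q\<zeta>: "inner (Q \<zeta>) \<zeta> > 0"
    using Q_pos by blast

  \<comment> \<open>The spectral subspace on which \<open>A\<close> is nonnegative, described
    without spectral projections.\<close>
  define M where "M = {x. Q x = A x}"
  have invariant: "C ` M \<subseteq> M" if "bounded_linear C" "\<And>y. C (A y) = A (C y)" for C
    using Q_comm[OF that, symmetric] that(2) by (auto simp: M_def)
  have commute: "G ` M \<subseteq> M \<and> cadjoint G ` M \<subseteq> M"
    if G: "bounded_clinear G" and WG: "\<And>x. W (G x) = G (W x)" for G
  proof
    have "W_inv (G x) = G (W_inv x)" for x
    proof -
      have "W_inv (W (G (W_inv x))) = W_inv (G x)"
        by (simp only: WG W_W_inv)
      then show ?thesis by simp
    qed
    then have GA: "G (A x) = A (G x)" for x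
      using bounded_clinearD(1)[OF G] by (simp add: A_def WG linear_add linear_scale bounded_linear.linear)
    then show "G ` M \<subseteq> M"
      by (rule invariant[OF bounded_clinearD(1)[OF G]])
    \<comment> \<open>Self-adjointness of \<open>A\<close> passes the commutation from
      \<open>G\<close> to its adjoint.\<close>
    have "cadjoint G (A x) = A (cadjoint G x)" for x
    proof (rule inner_eqI)
      show "inner z (cadjoint G (A x)) = inner z (A (cadjoint G x))" for z
        by (simp add: GA flip: inner_cadjoint(1)[OF G] A_selfadj)
    qed
    then show "cadjoint G ` M \<subseteq> M"
      by (rule invariant[OF bounded_clinearD(1)[OF bounded_clinear_cadjoint[OF G]]])
  qed
  have "closed M"
    unfolding M_def
    by (intro closed_Collect_eq linear_continuous_on A Q)
  moreover have "reducing_subspace m n S T M"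
    unfolding reducing_subspace_def
  proof (intro conjI ballI)
    \<comment> \<open>\<open>A\<close> is complex linear, so complex scalars are bounded real-linear
      operators to which \<open>invariant\<close> applies.\<close>
    have "c *\<^sub>C A x = A (c *\<^sub>C x)" for c x
      by (simp add: A_def bounded_clinearD(2)[OF W_bounded_clinear]
          bounded_clinearD(2)[OF W_inv_bounded_clinear] scaleC_add_right[symmetric]
          linear_scale[OF bounded_linear.linear[OF bounded_linear_scaleC]])
    then have "(\<lambda>x. c *\<^sub>C x) ` M \<subseteq> M" for c
      by (rule invariant[OF bounded_linear_scaleC])
    then show "csubspace M"
      by (intro complex_vector.subspaceI) (auto simp: M_def A.zero Q.zero A.add Q.add)
  next
    show "S i ` M \<subseteq> M" "cadjoint (S i) ` M \<subseteq> M" if "i \<in> {1..m}" for i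
      using commute[OF cuntz_bounded_clinear[OF S that] W_S[OF that]] by blast+
    show "T j ` M \<subseteq> M" "cadjoint (T j) ` M \<subseteq> M" if "j \<in> {1..n}" for j
      using commute[OF cuntz_bounded_clinear[OF T that] W_T[OF that]] by blast+
  qed
  ultimately consider "M = {0}" | "M = UNIV"
    using irreducible unfolding irreducible_rep_def by blast
  then show False
  proof cases
    case 1
    \<comment> \<open>Since \<open>Q\<close> and \<open>A\<close> commute and have equal squares,
      \<open>(Q - A) (Q + A) = 0\<close>.\<close>
    have "Q (Q \<zeta> + A \<zeta>) = A (Q \<zeta> + A \<zeta>)"
      using Q_comm[OF A refl] by (simp add: Q.add A.add QQ add.commute)
    then have "Q \<zeta> + A \<zeta> \<in> M"
      by (simp add: M_def)
    then have "inner (Q \<zeta> + A \<zeta>) \<zeta> = 0"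
      using 1 by simp
    then show ?thesis
      using A\<zeta> Q\<zeta> by (simp add: inner_add_left)
  next
    case 2
    then have "Q \<zeta> = A \<zeta>"
      by (auto simp: M_def)
    then show ?thesis
      using A\<zeta> Q\<zeta> by simp
  qed
qed

end

section \<open>Semigroup elements and their operators\<close>

lemma equivclp_Egen_count:
  assumes "equivclp (theta_step m n \<theta>) x y"
  shows "length (filter (\<lambda>g. \<exists>i. g = Egen i) x) = length (filter (\<lambda>g. \<exists>i. g = Egen i) y)"
  using assms
proof (induction rule: equivclp_induct)
  case (step y z)
  then show ?case
    by (auto elim!: theta_step.cases)
qed simp

lemma theta_class_eqD:
  assumes "x \<in> generator_words m n" and "y \<in> generator_words m n"
    and "theta_equiv m n \<theta> `` {x} = theta_equiv m n \<theta> `` {y}"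
  shows "equivclp (theta_step m n \<theta>) x y"
  using eq_equiv_class_iff[OF equiv_theta_equiv assms(1,2)] assms(3)
  by (simp add: theta_equiv_def)

lemma ef_in_two_graph:
  "u \<in> words m \<Longrightarrow> v \<in> words n \<Longrightarrow> ef m n \<theta> u v \<in> two_graph m n \<theta>"
  unfolding ef_def two_graph_def by (intro quotientI ef_word_in)

text \<open>\<open>rep_op\<close> is evaluated on forms with the \<open>e\<close> letters first; for
  classes given with the \<open>f\<close> letters first, operators are compared along the word
  congruence.\<close>

lemma word_op_ef_fe:
  assumes "cuntz_type_rep m n \<theta> S T"
    and "u \<in> words m" and "v \<in> words n" and "u' \<in> words m" and "v' \<in> words n"
    and "ef m n \<theta> u v = fe m n \<theta> v' u'"
  shows "word_op S u (word_op T v x) = word_op T v' (word_op S u' x)"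
proof -
  have "map Fgen v' @ map Egen u' \<in> generator_words m n"
    using assms(4,5) by (auto simp: generator_words_def lists_eq_set)
  then have "equivclp (theta_step m n \<theta>) (map Egen u @ map Fgen v) (map Fgen v' @ map Egen u')"
    using assms(6) unfolding ef_def fe_def by (intro theta_class_eqD ef_word_in assms(2,3))
  then have "foldr (gen_op S T) (map Egen u @ map Fgen v) x =
      foldr (gen_op S T) (map Fgen v' @ map Egen u') x"
    using equivclp_gen_op[OF assms(1)] by metis
  then show ?thesis
    by (simp add: word_op_def foldr_map o_def)
qed

text \<open>The two semigroup elements differ because every relation preserves the number of
  \<open>e\<close> letters, which is 0 for one and positive for the other.\<close>

lemma wandering_orthogonal:
  assumes rep: "cuntz_type_rep m n \<theta> S T" and "wandering m n \<theta> S T \<zeta>"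
    and u: "u \<in> words m" and v: "v \<in> words n" and "u \<noteq> []"
  shows "inner (word_op T v \<zeta>) (word_op S u \<zeta>) = 0"
proof -
  have "ef m n \<theta> [] v \<noteq> ef m n \<theta> u []"
  proof
    assume "ef m n \<theta> [] v = ef m n \<theta> u []"
    then have "equivclp (theta_step m n \<theta>) (map Egen [] @ map Fgen v) (map Egen u @ map Fgen [])"
      unfolding ef_def using u v by (intro theta_class_eqD ef_word_in) auto
    from equivclp_Egen_count[OF this] show False
      using \<open>u \<noteq> []\<close> by (simp add: filter_map o_def)
  qed
  then have "cinner (rep_op m n \<theta> S T (ef m n \<theta> [] v) \<zeta>) (rep_op m n \<theta> S T (ef m n \<theta> u []) \<zeta>) = 0"
    using assms(2) ef_in_two_graph[of "[]" m v n \<theta>] ef_in_two_graph[of u m "[]" n \<theta>] u v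
    unfolding wandering_def by simp
  then show ?thesis
    using u v by (simp add: rep_op_ef[OF rep] inner_eq_Re_cinner)
qed

lemma periodic_pair_if_periodic:
  fixes S T :: "nat \<Rightarrow> 'h::complex_hilbert \<Rightarrow> 'h"
  assumes \<theta>: "bij_betw \<theta> (index_box m n) (index_box m n)"
    and "periodic m n \<theta>" and rep: "cuntz_type_rep m n \<theta> S T"
  obtains a b \<gamma> where "periodic_pair m n a b \<gamma> S T"
proof -
  obtain a b \<gamma> where ab: "a > 0" "b > 0"
    and \<gamma>: "bij_betw \<gamma> (words_of_length m a) (words_of_length n b)"
    and eq: "\<And>u v. u \<in> words_of_length m a \<Longrightarrow> v \<in> words_of_length n b \<Longrightarrow>
      ef m n \<theta> u v = fe m n \<theta> (\<gamma> u) (inv_into (words_of_length m a) \<gamma> v)"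
  proof -
    obtain a b \<gamma> where "a > 0" "b > 0"
      and bij: "bij_betw \<gamma> {u \<in> words m. length u = a} {v \<in> words n. length v = b}"
      and eq: "\<forall>u \<in> words m. \<forall>v \<in> words n. length u = a \<longrightarrow> length v = b \<longrightarrow>
        ef m n \<theta> u v = fe m n \<theta> (\<gamma> u) (inv_into {u \<in> words m. length u = a} \<gamma> v)"
      using assms(2) unfolding periodic_def by blast
    then show thesis
      using that[of a b \<gamma>] by (simp add: words_of_length_def)
  qed
  have comm: "S i (T j x) = T j' (S i' x)" if "(i, j) \<in> index_box m n" "\<theta> (i, j) = (i', j')" for i j i' j' x
  proof -
    have "S i \<circ> T j = T j' \<circ> S i'"
      using rep that unfolding cuntz_type_rep_def by blast
    from fun_cong[OF this, of x] show ?thesis by simp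
  qed
  have "periodic_pair m n a b \<gamma> S T"
  proof
    show "cuntz_family m S" "cuntz_family n T"
      using rep by (simp_all add: cuntz_type_rep_def)
    show "\<exists>j' \<in> {1..n}. \<exists>i' \<in> {1..m}. \<forall>x. S i (T j x) = T j' (S i' x)"
      if "i \<in> {1..m}" "j \<in> {1..n}" for i j
    proof -
      have ij: "(i, j) \<in> index_box m n"
        using that by (simp add: index_box_def)
      obtain i' j' where "\<theta> (i, j) = (i', j')"
        by fastforce
      moreover from this have "i' \<in> {1..m}" "j' \<in> {1..n}"
        using bij_betwE[OF \<theta>] ij by (force simp: index_box_def)+
      ultimately show ?thesis
        using comm[OF ij] by blast
    qed
    show "\<exists>i' \<in> {1..m}. \<exists>j' \<in> {1..n}. \<forall>x. T j (S i x) = S i' (T j' x)"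
      if "j \<in> {1..n}" "i \<in> {1..m}" for i j
    proof -
      \<comment> \<open>Starting from \<open>T j (S i x)\<close> the relation is read backwards,
        which calls for a preimage under \<open>\<theta>\<close>.\<close>
      have "(i, j) \<in> \<theta> ` index_box m n"
        using that bij_betw_imp_surj_on[OF \<theta>] by (simp add: index_box_def)
      then obtain i' j' where ij: "\<theta> (i', j') = (i, j)" "(i', j') \<in> index_box m n"
        by force
      moreover from this have "i' \<in> {1..m}" "j' \<in> {1..n}"
        by (simp_all add: index_box_def)
      ultimately show ?thesis
        using comm[OF ij(2,1), symmetric] by blast
    qed
    fix u u' x assume u: "u \<in> words_of_length m a" and u': "u' \<in> words_of_length m a"
    then have "\<gamma> u \<in> words_of_length n b" "\<gamma> u' \<in> words_of_length n b"
      using bij_betwE[OF \<gamma>] by blast+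
    \<comment> \<open>Periodicity is applied with \<open>\<gamma> u'\<close> as second word, so the
      inverse bijection returns \<open>u'\<close>.\<close>
    then show "word_op S u (word_op T (\<gamma> u') x) = word_op T (\<gamma> u) (word_op S u' x)"
      using eq[OF u, of "\<gamma> u'"] u u' bij_betw_inv_into_left[OF \<gamma> u']
      by (intro word_op_ef_fe[OF rep]) (simp_all add: words_of_length_def)
  qed (fact ab \<gamma>)+
  then show thesis by (rule that)
qed

theorem proposition6p5:
  fixes m n :: nat and \<theta> :: "nat \<times> nat \<Rightarrow> nat \<times> nat"
    and S T :: "nat \<Rightarrow> 'h::complex_hilbert \<Rightarrow> 'h" and \<xi> :: "nat \<Rightarrow> 'h"
  assumes "m \<ge> 2" and "n \<ge> 2"
    and "bij_betw \<theta> (index_box m n) (index_box m n)"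
    and "periodic m n \<theta>"
    and "cuntz_type_rep m n \<theta> S T"
    and "irreducible_rep m n S T"
    and "atomic_rep m n \<theta> S T \<xi>"
    and "type_1 m n S T \<xi> \<or> type_3b_ii m n \<theta> S T \<xi>"
  shows "\<not> (\<exists>\<zeta>. wandering m n \<theta> S T \<zeta>)"
proof
  assume "\<exists>\<zeta>. wandering m n \<theta> S T \<zeta>"
  then obtain \<zeta> where \<zeta>: "wandering m n \<theta> S T \<zeta>" by blast
  obtain a b \<gamma> where "periodic_pair m n a b \<gamma> S T"
    using periodic_pair_if_periodic[OF assms(3-5)] by blast
  then interpret periodic_pair m n a b \<gamma> S T .
  define u where "u = replicate a (1::nat)"
  have u: "u \<in> words_of_length m a"
    unfolding u_def using assms(1) by (intro replicate_in_words_of_length) simp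
  have "u \<noteq> []"
    using a_pos by (simp add: u_def)
  have u_words: "u \<in> words m" and v_words: "\<gamma> u \<in> words n"
    using u \<gamma>_in[OF u] by (simp_all add: words_of_length_def)
  note orth = wandering_orthogonal[OF assms(5) \<zeta>]
  note iso = word_op_inner[OF S u u, simplified]
  have W_u: "word_op S u (W x) = word_op T (\<gamma> u) x" for x
    using W_word_commute[OF u] W_word[OF u] by simp
  \<comment> \<open>The isometry \<open>word_op S u\<close> is applied to both arguments; it turns
    \<open>W \<zeta>\<close> into \<open>word_op T (\<gamma> u) \<zeta>\<close>.\<close>
  have "inner (W \<zeta>) \<zeta> = inner (word_op T (\<gamma> u) \<zeta>) (word_op S u \<zeta>)"
    using iso[of "W \<zeta>" \<zeta>] by (simp add: W_u)
  also have "\<dots> = 0"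
    by (rule orth[OF u_words v_words \<open>u \<noteq> []\<close>])
  finally have W1: "inner (W \<zeta>) \<zeta> = 0" .
  \<comment> \<open>Each copy of \<open>W\<close> is absorbed by one copy of \<open>u\<close>, so
    the word \<open>u @ u\<close> handles the square of \<open>W\<close>.\<close>
  have "word_op S u (word_op S u (W (W \<zeta>))) = word_op T (\<gamma> u) (word_op T (\<gamma> u) \<zeta>)"
    by (simp only: W_word_commute[OF u, symmetric] W_word[OF u])
  then have "inner (W (W \<zeta>)) \<zeta> = inner (word_op T (\<gamma> u @ \<gamma> u) \<zeta>) (word_op S (u @ u) \<zeta>)"
    using iso[of "word_op S u (W (W \<zeta>))" "word_op S u \<zeta>"] iso[of "W (W \<zeta>)" \<zeta>]
    by (simp add: word_op_append)
  also have "\<dots> = 0"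
    by (rule orth) (use u_words v_words \<open>u \<noteq> []\<close> in simp_all)
  finally have W2: "inner (W (W \<zeta>)) \<zeta> = 0" .
  have "\<zeta> \<noteq> 0"
    using \<zeta> by (auto simp: wandering_def)
  then show False
    using not_irreducible_if_orthogonal[OF _ W1 W2] assms(6) by blast
qed

end
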